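(* There exist absolute constants $C>0$ and $c>0$ such that for all integers $d\ge1$, $1\le s\le cd$, all $\sigma>0$, any $\boldsymbol\theta\in B_0(s,d)$ and any $\boldsymbol\Sigma$ satisfying Assumption $(\varepsilon^*1)$, \[ \mathbf E_{\boldsymbol\theta,\boldsymbol\Sigma}\left[\frac{|\hat\sigma_D^2-\sigma^2|}{\sigma^2}\right]\le C\left(\frac{s}{d\,(1\vee\log(s/\|\tilde{\boldsymbol\Sigma}\|_F))}+\frac{\|\tilde{\boldsymbol\Sigma}\|_F}{d}\right). \]
   Context: Model: one observes $\boldsymbol Y=\boldsymbol\theta+\sigma\boldsymbol\varepsilon\in\mathbb R^d$, $\boldsymbol\varepsilon\sim\mathcal N(\boldsymbol0,\boldsymbol\Sigma)$, $\boldsymbol\Sigma$ a covariance matrix with known diagonal entries $\sigma_i^2$, $\sigma>0$ unknown; $\mathbf E_{\boldsymbol\theta,\boldsymbol\Sigma}$ is the expectation under this model. $B_0(s,d)=\{\boldsymbol\theta:\|\boldsymbol\theta\|_0\le s\}$. Assumption $(\varepsilon^*1)$: $\min_i\sigma_i^2\ge c_*$ for a constant $c_*>0$. $\tilde Y_i=Y_i/\sigma_i$, $\tilde{\boldsymbol\Sigma}_{ij}=\boldsymbol\Sigma_{ij}/(\sigma_i\sigma_j)$. $\hat F_{Y^2}$ is the empirical c.d.f. of $\tilde Y_1^2,\dots,\tilde Y_d^2$, $F$ the c.d.f. of $\chi^2_1$; $\hat\sigma_S^2(t)=t/F^{-1}(\hat F_{Y^2}(t))$ if $\hat F_{Y^2}(t)>0$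 and $+\infty$ otherwise; $\hat t=\min\{2^\ell:\ell\in\mathbb Z,\ \hat F_{Y^2}(2^\ell)\ge0.5\}$; $\hat\sigma_S^2=\hat\sigma_S^2(\hat t)$. Let $\hat\varphi_d(u)=\frac1d\sum_{i=1}^d\cos(u\tilde Y_i)$, $\lambda=\frac{1\vee\log(s/\|\tilde{\boldsymbol\Sigma}\|_F)}{6}$, $\tilde\sigma_D^2=-\frac{2\hat t}{\lambda}\log\big|\hat\varphi_d(\sqrt{\lambda/\hat t})\big|$, and $\hat\sigma_D^2=\min\{\tilde\sigma_D^2,2\hat\sigma_S^2\}$. *)

theory Defs
  imports "HOL-Probability.Probability"
begin

(* Vectors in R^d are functions nat => real (only indices < d matter),
   d x d matrices are functions nat => nat => real. *)

definition B0 :: "nat \<Rightarrow> nat \<Rightarrow> (nat \<Rightarrow> real) set" where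
  "B0 s d = {\<theta>. card {i \<in> {..<d}. \<theta> i \<noteq> 0} \<le> s}"

text \<open>Law of Y = theta + sigma * eps, eps ~ N(0, Sigma), realised as eps = A Z with Z a
  standard Gaussian vector and Sigma = A A^T.\<close>
definition obs_model :: "nat \<Rightarrow> (nat \<Rightarrow> real) \<Rightarrow> real \<Rightarrow> (nat \<Rightarrow> nat \<Rightarrow> real) \<Rightarrow> (nat \<Rightarrow> real) measure" where
  "obs_model d \<theta> \<sigma> A =
     distr (PiM {..<d} (\<lambda>_. density lborel std_normal_density)) (PiM {..<d} (\<lambda>_. borel))
       (\<lambda>z. restrict (\<lambda>i. \<theta> i + \<sigma> * (\<Sum>j<d. A i j * z j)) {..<d})"

definition chi2_1_cdf :: "real \<Rightarrow> real" where
  "chi2_1_cdf t = measure (density lborel std_normal_density) {z. z\<^sup>2 \<le> t}"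

definition chi2_1_quantile :: "real \<Rightarrow> real" where
  "chi2_1_quantile p = (THE x. 0 \<le> x \<and> chi2_1_cdf x = p)"

definition Ytil :: "(nat \<Rightarrow> nat \<Rightarrow> real) \<Rightarrow> (nat \<Rightarrow> real) \<Rightarrow> nat \<Rightarrow> real" where
  "Ytil \<Sigma> Y i = Y i / sqrt (\<Sigma> i i)"

definition emp_cdf :: "nat \<Rightarrow> (nat \<Rightarrow> nat \<Rightarrow> real) \<Rightarrow> (nat \<Rightarrow> real) \<Rightarrow> real \<Rightarrow> real" where
  "emp_cdf d \<Sigma> Y t = real (card {i \<in> {..<d}. (Ytil \<Sigma> Y i)\<^sup>2 \<le> t}) / real d"

text \<open>sigma_S^2(t) = t / F^{-1}(F_hat(t)), +infinity if F_hat(t) = 0; F^{-1}(1) = +infinity,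
  so the value is 0 when F_hat(t) = 1.\<close>
definition sigmaS_sq :: "nat \<Rightarrow> (nat \<Rightarrow> nat \<Rightarrow> real) \<Rightarrow> (nat \<Rightarrow> real) \<Rightarrow> real \<Rightarrow> ereal" where
  "sigmaS_sq d \<Sigma> Y t =
     (if emp_cdf d \<Sigma> Y t = 0 then \<infinity>
      else if emp_cdf d \<Sigma> Y t \<ge> 1 then 0
      else ereal (t / chi2_1_quantile (emp_cdf d \<Sigma> Y t)))"

definition t_hat :: "nat \<Rightarrow> (nat \<Rightarrow> nat \<Rightarrow> real) \<Rightarrow> (nat \<Rightarrow> real) \<Rightarrow> real" where
  "t_hat d \<Sigma> Y = 2 powr real_of_int (Inf {l::int. emp_cdf d \<Sigma> Y (2 powr real_of_int l) \<ge> 1/2})"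

definition sigmaS_hat_sq :: "nat \<Rightarrow> (nat \<Rightarrow> nat \<Rightarrow> real) \<Rightarrow> (nat \<Rightarrow> real) \<Rightarrow> ereal" where
  "sigmaS_hat_sq d \<Sigma> Y = sigmaS_sq d \<Sigma> Y (t_hat d \<Sigma> Y)"

definition frob_til :: "nat \<Rightarrow> (nat \<Rightarrow> nat \<Rightarrow> real) \<Rightarrow> real" where
  "frob_til d \<Sigma> = sqrt (\<Sum>i<d. \<Sum>j<d. (\<Sigma> i j / (sqrt (\<Sigma> i i) * sqrt (\<Sigma> j j)))\<^sup>2)"

definition lam :: "nat \<Rightarrow> nat \<Rightarrow> (nat \<Rightarrow> nat \<Rightarrow> real) \<Rightarrow> real" where
  "lam d s \<Sigma> = max 1 (ln (real s / frob_til d \<Sigma>)) / 6"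

definition phi_hat :: "nat \<Rightarrow> (nat \<Rightarrow> nat \<Rightarrow> real) \<Rightarrow> (nat \<Rightarrow> real) \<Rightarrow> real \<Rightarrow> real" where
  "phi_hat d \<Sigma> Y u = (\<Sum>i<d. cos (u * Ytil \<Sigma> Y i)) / real d"

text \<open>sigma_tilde_D^2 = -(2 t_hat / lambda) log |phi_hat(sqrt(lambda / t_hat))|
  (= +infinity when phi_hat vanishes, since log 0 = -infinity).\<close>
definition sigmaD_til_sq :: "nat \<Rightarrow> nat \<Rightarrow> (nat \<Rightarrow> nat \<Rightarrow> real) \<Rightarrow> (nat \<Rightarrow> real) \<Rightarrow> ereal" where
  "sigmaD_til_sq d s \<Sigma> Y =
     (let t = t_hat d \<Sigma> Y; l = lam d s \<Sigma>; p = phi_hat d \<Sigma> Y (sqrt (l / t)) in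
      if p = 0 then \<infinity> else ereal (- (2 * t / l) * ln \<bar>p\<bar>))"

definition sigmaD_hat_sq :: "nat \<Rightarrow> nat \<Rightarrow> (nat \<Rightarrow> nat \<Rightarrow> real) \<Rightarrow> (nat \<Rightarrow> real) \<Rightarrow> ereal" where
  "sigmaD_hat_sq d s \<Sigma> Y = min (sigmaD_til_sq d s \<Sigma> Y) (2 * sigmaS_hat_sq d \<Sigma> Y)"

end

theory Submission
  imports Defs
begin

text \<open>
  Let \<open>X\<^sub>i\<close> be the normalised noise, \<open>\<rho>\<close> its correlation matrix and \<open>F\<close> the Frobenius norm of \<open>\<rho>\<close>.
  Averages of even functions of \<open>X\<^sub>i\<close> have variance \<open>O(F\<^sup>2 / d\<^sup>2)\<close>; for \<open>cos\<close> the covariance is explicit,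
  and a shift of the argument adds a term linear in \<open>\<rho>\<close>, which only occurs for pairs of outliers and
  contributes at most \<open>s F\<close> in total. Majorising the indicator of an interval by a trigonometric
  polynomial turns this into control of the empirical c.d.f.: outside an event whose probability is
  \<open>O(F\<^sup>2 / d\<^sup>2)\<close>, \<open>t_hat\<close> is one of seven dyadic numbers between \<open>\<sigma>\<^sup>2 / 4\<close> and \<open>40 \<sigma>\<^sup>2\<close>, and
  \<open>2 sigmaS_hat_sq \<ge> \<sigma>\<^sup>2\<close>, so the truncation does no harm. On that event the error is governed by
  the relative error \<open>R\<close> of the empirical characteristic function. Its bias is at most \<open>2 s / d\<close> because
  outliers carry noise too, so their contribution is damped by the same factor
  \<open>\<phi> = exp (- \<lambda> \<sigma>\<^sup>2 / (2 t))\<close>. Its standard deviation is at most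
  \<open>sqrt (F\<^sup>2 + s F) / (d \<phi>)\<close>, where \<open>1 / \<phi> \<le> (s / F) powr (1/3)\<close> if \<open>s \<ge> exp 1 * F\<close>, which is where
  the \<open>6\<close> in the definition of \<open>\<lambda>\<close> and the bound \<open>t_hat \<ge> \<sigma>\<^sup>2 / 4\<close> are used. On the bad event,
  \<open>sigmaD_hat_sq \<le> 8 t_hat\<close> and the second moment of \<open>t_hat\<close> is bounded.
\<close>

text \<open>The integrand need not be measurable: the estimator is bounded by a measurable function only
  after the integral has been pulled back to the Gaussian space.\<close>

lemma nn_integral_distr_le:
  assumes T: "T \<in> measurable M N"
  shows "(\<integral>\<^sup>+ y. f y \<partial>distr M N T) \<le> (\<integral>\<^sup>+ x. f (T x) \<partial>M)"
proof -
  have "integral\<^sup>S (distr M N T) g \<le> (\<integral>\<^sup>+ x. f (T x) \<partial>M)"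
    if g: "simple_function (distr M N T) g" "g \<le> f" for g
  proof -
    have "integral\<^sup>S (distr M N T) g = (\<integral>\<^sup>+ y. g y \<partial>distr M N T)"
      using g(1) by (simp add: nn_integral_eq_simple_integral)
    also have "\<dots> = (\<integral>\<^sup>+ x. g (T x) \<partial>M)"
      using borel_measurable_simple_function[OF g(1)] by (intro nn_integral_distr T) simp
    also have "\<dots> \<le> (\<integral>\<^sup>+ x. f (T x) \<partial>M)"
      using g(2) by (intro nn_integral_mono) (auto simp: le_fun_def)
    finally show ?thesis .
  qed
  then show ?thesis
    by (subst nn_integral_def) (auto intro!: SUP_least)
qed

section \<open>Laws and integrals of Gaussian linear combinations\<close>

lemma char_distr_scaled_std_normal:
  "char (distr std_normal_distribution borel (\<lambda>z. q * z)) t = exp (- (q * t)\<^sup>2 / 2)"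
proof -
  have "char (distr std_normal_distribution borel (\<lambda>z. q * z)) t
      = (CLINT z|std_normal_distribution. iexp (t * (q * z)))"
    unfolding char_def by (subst integral_distr) auto
  also have "\<dots> = char std_normal_distribution (q * t)"
    unfolding char_def by (simp add: ac_simps)
  finally show ?thesis
    by (simp add: char_std_normal_distribution)
qed

text \<open>By independence the characteristic function factorises, and the product depends on
  \<open>b\<close> only through its sum of squares; Levy uniqueness then identifies the laws.
  Writing the right-hand side as the image of a scaling includes the degenerate case of a zero sum
  of squares.\<close>

lemma distr_gaussian_linear_combination:
  fixes b :: "nat \<Rightarrow> real"
  shows "distr (PiM {..<d} (\<lambda>_. std_normal_distribution)) borel (\<lambda>z. \<Sum>j<d. b j * z j)
    = distr std_normal_distribution borel (\<lambda>z. sqrt (\<Sum>j<d. (b j)\<^sup>2) * z)"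
proof -
  interpret N: real_distribution std_normal_distribution by (rule real_dist_normal_dist)
  interpret P: product_prob_space "\<lambda>_::nat. std_normal_distribution" "{..<d}" by standard
  let ?P = "PiM {..<d} (\<lambda>_::nat. std_normal_distribution)"
  have sets[measurable_cong]: "sets ?P = sets (PiM {..<d} (\<lambda>_. borel))"
    by (intro sets_PiM_cong) auto
  have meas[measurable]: "(\<lambda>z. \<Sum>j<d. b j * z j) \<in> borel_measurable ?P"
    by measurable
  show ?thesis
  proof (rule Levy_uniqueness)
    show "real_distribution (distr ?P borel (\<lambda>z. \<Sum>j<d. b j * z j))"
      by (intro P.real_distribution_distr) auto
    show "real_distribution (distr std_normal_distribution borel (\<lambda>z. sqrt (\<Sum>j<d. (b j)\<^sup>2) * z))"
      by (intro N.real_distribution_distr) auto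
    show "char (distr ?P borel (\<lambda>z. \<Sum>j<d. b j * z j))
        = char (distr std_normal_distribution borel (\<lambda>z. sqrt (\<Sum>j<d. (b j)\<^sup>2) * z))"
    proof
      fix t :: real
      have "char (distr ?P borel (\<lambda>z. \<Sum>j<d. b j * z j)) t
          = (CLINT z|?P. iexp (t * (\<Sum>j<d. b j * z j)))"
        unfolding char_def by (subst integral_distr) auto
      also have "\<dots> = (CLINT z|?P. (\<Prod>j<d. iexp (t * b j * z j)))"
        by (simp add: sum_distrib_left exp_sum ac_simps)
      also have "\<dots> = (\<Prod>j<d. (CLINT x|std_normal_distribution. iexp (t * b j * x)))"
        by (rule P.product_integral_prod) (auto intro!: N.integrable_iexp)
      also have "\<dots> = (\<Prod>j<d. char std_normal_distribution (t * b j))"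
        by (simp add: char_def)
      also have "\<dots> = complex_of_real (exp (\<Sum>j<d. - (t * b j)\<^sup>2 / 2))"
        by (simp add: char_std_normal_distribution exp_sum)
      also have "(\<Sum>j<d. - (t * b j)\<^sup>2 / 2) = - (sqrt (\<Sum>j<d. (b j)\<^sup>2) * t)\<^sup>2 / 2"
        by (simp add: power_mult_distrib sum_nonneg sum_distrib_left sum_negf sum_divide_distrib ac_simps)
      finally show "char (distr ?P borel (\<lambda>z. \<Sum>j<d. b j * z j)) t
        = char (distr std_normal_distribution borel (\<lambda>z. sqrt (\<Sum>j<d. (b j)\<^sup>2) * z)) t"
        by (simp add: char_distr_scaled_std_normal)
    qed
  qed
qed

text \<open>The phase factors out of the complex exponential and the remaining characteristic
  function is real, so only the real part of the phase survives.\<close>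

lemma std_normal_integral_cos:
  "(\<integral>z. cos (\<alpha> + t * z) \<partial>std_normal_distribution) = cos \<alpha> * exp (- t\<^sup>2 / 2)"
proof -
  interpret N: real_distribution std_normal_distribution by (rule real_dist_normal_dist)
  have int: "integrable std_normal_distribution (\<lambda>z. iexp (t * z))"
    by (intro N.integrable_iexp) auto
  have "(\<integral>z. cos (\<alpha> + t * z) \<partial>std_normal_distribution)
      = (\<integral>z. Re (iexp \<alpha> * iexp (t * z)) \<partial>std_normal_distribution)"
    by (simp add: exp_add[symmetric] distrib_left[symmetric] Re_exp)
  also have "\<dots> = Re (CLINT z|std_normal_distribution. iexp \<alpha> * iexp (t * z))"
    using int by (intro integral_Re) auto
  also have "\<dots> = Re (iexp \<alpha> * char std_normal_distribution t)"
    by (simp add: char_def)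
  also have "\<dots> = cos \<alpha> * exp (- t\<^sup>2 / 2)"
    by (simp add: char_std_normal_distribution Re_exp)
  finally show ?thesis .
qed

lemma std_normal_integral_pow2: "(\<integral>z. z\<^sup>2 \<partial>std_normal_distribution) = 1"
  using std_normal_distribution_even_moments(1)[of 1] by simp

lemma std_normal_integral_pow4: "(\<integral>z. z ^ 4 \<partial>std_normal_distribution) = 3"
  using std_normal_distribution_even_moments(1)[of 2] by (simp add: fact_numeral)

section \<open>Elementary facts on cosines and hyperbolic functions\<close>

lemma trig_power_expansion:
  "\<exists>\<beta>::nat \<Rightarrow> real. \<forall>\<theta>. cos \<theta> ^ k = (\<Sum>j\<le>k. \<beta> j * cos (real j * \<theta>))"
proof (induction k)
  case 0
  show ?case by (rule exI[of _ "\<lambda>_. 1"]) simp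
next
  case (Suc k)
  then obtain \<beta> :: "nat \<Rightarrow> real" where \<beta>: "\<And>\<theta>. cos \<theta> ^ k = (\<Sum>j\<le>k. \<beta> j * cos (real j * \<theta>))"
    by blast
  define f where "f j = (\<beta> j / 2)" for j
  \<comment> \<open>The product of the cosines at frequencies 1 and j is half the sum of those at j
    + 1 and j - 1. The last summand treats j = 0, whose frequency -1 folds back to 1.\<close>
  define \<gamma> where "\<gamma> j = (if j = 0 then 0 else f (j - 1)) + (if j < k then f (Suc j) else 0)
      + (if j = 1 then f 0 else 0)" for j
  have "cos \<theta> ^ Suc k = (\<Sum>j\<le>Suc k. \<gamma> j * cos (real j * \<theta>))" for \<theta>
  proof -
    have "cos \<theta> ^ Suc k = (\<Sum>j\<le>k. \<beta> j * (cos \<theta> * cos (real j * \<theta>)))"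
      by (simp add: \<beta> sum_distrib_left ac_simps)
    also have "\<dots> = (\<Sum>j\<le>k. f j * cos (real (Suc j) * \<theta>) + f j * cos ((real j - 1) * \<theta>))"
      by (intro sum.cong refl) (simp add: f_def cos_add cos_diff left_diff_distrib distrib_right, simp add: field_simps)
    also have "\<dots> = (\<Sum>j\<le>k. f j * cos (real (Suc j) * \<theta>)) + (\<Sum>j\<le>k. f j * cos ((real j - 1) * \<theta>))"
      by (simp add: sum.distrib)
    also have "(\<Sum>j\<le>k. f j * cos (real (Suc j) * \<theta>))
        = (\<Sum>j\<le>Suc k. (if j = 0 then 0 else f (j - 1)) * cos (real j * \<theta>))"
      by (subst sum.atMost_Suc_shift) simp
    also have "(\<Sum>j\<le>k. f j * cos ((real j - 1) * \<theta>))
       = f 0 * cos \<theta> + (\<Sum>j<k. f (Suc j) * cos (real j * \<theta>))"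
      by (subst sum.atMost_shift) simp
    also have "(\<Sum>j<k. f (Suc j) * cos (real j * \<theta>))
        = (\<Sum>j\<le>Suc k. (if j < k then f (Suc j) else 0) * cos (real j * \<theta>))"
      by (intro sum.mono_neutral_cong_left) auto
    also have "f 0 * cos \<theta> = (\<Sum>j\<le>Suc k. (if j = 1 then f 0 else 0) * cos (real j * \<theta>))"
      by (subst sum.mono_neutral_cong_right[where S="{1}" and h="\<lambda>_. f 0 * cos \<theta>"]) auto
    finally show ?thesis
      unfolding \<gamma>_def by (simp only: sum.distrib[symmetric] distrib_right distrib_left ac_simps)
  qed
  then show ?case by blast
qed

text \<open>Convexity of \<open>sinh\<close> on the half line together with
  \<open>sinh 0 = 0\<close>, proved by comparing derivatives. It pulls the correlation out of a
  hyperbolic function at any frequency.\<close>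

lemma sinh_mult_le:
  fixes r y :: real
  assumes "0 \<le> r" "r \<le> 1" "0 \<le> y"
  shows "sinh (r * y) \<le> r * sinh y"
proof -
  have "(\<lambda>y. r * sinh y - sinh (r * y)) 0 \<le> (\<lambda>y. r * sinh y - sinh (r * y)) y"
  proof (rule DERIV_nonneg_imp_nondecreasing[OF assms(3)])
    fix x assume x: "0 \<le> x" "x \<le> y"
    have "((\<lambda>y. r * sinh y - sinh (r * y)) has_real_derivative r * (cosh x - cosh (r * x))) (at x)"
      by (auto intro!: derivative_eq_intros simp: algebra_simps)
    moreover have "cosh (r * x) \<le> cosh x"
      using x assms by (subst cosh_real_nonneg_le_iff) (auto simp: mult_left_le_one_le)
    ultimately show "\<exists>z. ((\<lambda>y. r * sinh y - sinh (r * y)) has_real_derivative z) (at x) \<and> 0 \<le> z"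
      using assms by (intro exI[of _ "r * (cosh x - cosh (r * x))"]) auto
  qed
  then show ?thesis by simp
qed

section \<open>Correlated standard Gaussian variables\<close>

text \<open>The laws of single coordinates, sums and differences determine all second-order
  quantities used below, because products of cosines or of squares of two coordinates polarise into
  functions of these. Laws given as images of a scaling also cover correlations 1 and -1.\<close>

locale std_gaussian_family = prob_space M for M :: "'a measure" +
  fixes d :: nat and X :: "nat \<Rightarrow> 'a \<Rightarrow> real" and \<rho> :: "nat \<Rightarrow> nat \<Rightarrow> real"
  assumes rv [measurable]: "\<And>i. i < d \<Longrightarrow> X i \<in> borel_measurable M"
    and distr_X: "\<And>i. i < d \<Longrightarrow> distr M borel (X i) = std_normal_distribution"
    and distr_add: "\<And>i j. i < d \<Longrightarrow> j < d \<Longrightarrow> distr M borel (\<lambda>x. X i x + X j x)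
      = distr std_normal_distribution borel (\<lambda>z. sqrt (2 + 2 * \<rho> i j) * z)"
    and distr_diff: "\<And>i j. i < d \<Longrightarrow> j < d \<Longrightarrow> distr M borel (\<lambda>x. X i x - X j x)
      = distr std_normal_distribution borel (\<lambda>z. sqrt (2 - 2 * \<rho> i j) * z)"
    and abs_corr_le_1: "\<And>i j. i < d \<Longrightarrow> j < d \<Longrightarrow> \<bar>\<rho> i j\<bar> \<le> 1"
begin

lemma integral_X:
  fixes f :: "real \<Rightarrow> real"
  assumes [measurable]: "f \<in> borel_measurable borel" and i: "i < d"
  shows "(\<integral>x. f (X i x) \<partial>M) = (\<integral>z. f z \<partial>std_normal_distribution)"
  using integral_distr[of "X i" M borel f] i by (simp add: distr_X)

lemma integrable_X:
  fixes f :: "real \<Rightarrow> real"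
  assumes [measurable]: "f \<in> borel_measurable borel" and i: "i < d"
  shows "integrable M (\<lambda>x. f (X i x)) \<longleftrightarrow> integrable std_normal_distribution f"
  using integrable_distr_eq[of "X i" M borel f] i by (simp add: distr_X)

lemma expectation_add_X:
  fixes f :: "real \<Rightarrow> real"
  assumes [measurable]: "f \<in> borel_measurable borel" and ij: "i < d" "j < d"
  shows "(\<integral>x. f (X i x + X j x) \<partial>M)
    = (\<integral>z. f (sqrt (2 + 2 * \<rho> i j) * z) \<partial>std_normal_distribution)"
  using integral_distr[of "\<lambda>x. X i x + X j x" M borel f]
    integral_distr[of "\<lambda>z. sqrt (2 + 2 * \<rho> i j) * z" std_normal_distribution borel f] ij
  by (simp add: distr_add)

lemma expectation_diff_X:
  fixes f :: "real \<Rightarrow> real"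
  assumes [measurable]: "f \<in> borel_measurable borel" and ij: "i < d" "j < d"
  shows "(\<integral>x. f (X i x - X j x) \<partial>M)
    = (\<integral>z. f (sqrt (2 - 2 * \<rho> i j) * z) \<partial>std_normal_distribution)"
  using integral_distr[of "\<lambda>x. X i x - X j x" M borel f]
    integral_distr[of "\<lambda>z. sqrt (2 - 2 * \<rho> i j) * z" std_normal_distribution borel f] ij
  by (simp add: distr_diff)

lemma integrable_X_power: "i < d \<Longrightarrow> integrable M (\<lambda>x. X i x ^ k)"
  by (subst integrable_X[where f="\<lambda>z. z ^ k"]) (auto intro: integrable_std_normal_distribution_moment)

section \<open>Means and covariances of shifted cosines\<close>

lemma expectation_cos:
  assumes "i < d"
  shows "expectation (\<lambda>x. cos (\<alpha> + w * X i x)) = cos \<alpha> * exp (- w\<^sup>2 / 2)"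
  using integral_X[OF _ assms, of "\<lambda>z. cos (\<alpha> + w * z)"] by (simp add: std_normal_integral_cos)

lemma expectation_cos_add:
  assumes "i < d" "j < d"
  shows "expectation (\<lambda>x. cos (\<alpha> + w * (X i x + X j x))) = cos \<alpha> * exp (- w\<^sup>2 * (1 + \<rho> i j))"
proof -
  have "2 + 2 * \<rho> i j \<ge> 0" using abs_corr_le_1[OF assms] by (auto simp: abs_le_iff)
  then show ?thesis
    using expectation_add_X[OF _ assms, of "\<lambda>z. cos (\<alpha> + w * z)"]
      std_normal_integral_cos[of \<alpha> "w * sqrt (2 + 2 * \<rho> i j)"]
    by (simp add: mult.assoc power_mult_distrib)
qed

lemma expectation_cos_diff:
  assumes "i < d" "j < d"
  shows "expectation (\<lambda>x. cos (\<alpha> + w * (X i x - X j x))) = cos \<alpha> * exp (- w\<^sup>2 * (1 - \<rho> i j))"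
proof -
  have "2 - 2 * \<rho> i j \<ge> 0" using abs_corr_le_1[OF assms] by (auto simp: abs_le_iff)
  then show ?thesis
    using expectation_diff_X[OF _ assms, of "\<lambda>z. cos (\<alpha> + w * z)"]
      std_normal_integral_cos[of \<alpha> "w * sqrt (2 - 2 * \<rho> i j)"]
    by (simp add: mult.assoc power_mult_distrib)
qed

lemma integrable_cos_X: "i < d \<Longrightarrow> integrable M (\<lambda>x. cos (\<alpha> + w * X i x))"
  by (rule integrable_const_bound[of _ 1]) auto

lemma integrable_cos_comb:
  "i < d \<Longrightarrow> j < d \<Longrightarrow> integrable M (\<lambda>x. cos (\<alpha> + w * (X i x + X j x)))"
  "i < d \<Longrightarrow> j < d \<Longrightarrow> integrable M (\<lambda>x. cos (\<alpha> + w * (X i x - X j x)))"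
  by (rule integrable_const_bound[of _ 1]; auto)+

text \<open>The phase \<alpha> stands for a frequency times the signal of the coordinate, so it
  vanishes for pure noise; \<open>w\<close> is the frequency times the noise level.\<close>

definition centred_cos :: "real \<Rightarrow> real \<Rightarrow> nat \<Rightarrow> 'a \<Rightarrow> real" where
  "centred_cos w \<alpha> i x = cos (\<alpha> + w * X i x) - cos \<alpha> * exp (- w\<^sup>2 / 2)"

lemma centred_cos_measurable [measurable]: "i < d \<Longrightarrow> centred_cos w \<alpha> i \<in> borel_measurable M"
  unfolding centred_cos_def by measurable

lemma abs_centred_cos_le: "\<bar>centred_cos w \<alpha> i x\<bar> \<le> 2"
proof -
  have "\<bar>cos \<alpha> * exp (- w\<^sup>2 / 2)\<bar> \<le> 1" by (auto simp: abs_mult intro!: mult_le_one)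
  moreover have "\<bar>cos (\<alpha> + w * X i x)\<bar> \<le> 1" by simp
  ultimately show ?thesis unfolding centred_cos_def by linarith
qed

lemma integrable_centred_cos_mult:
  assumes "i < d" "j < d"
  shows "integrable M (\<lambda>x. centred_cos w \<alpha> i x * centred_cos w \<beta> j x)"
proof (rule integrable_const_bound[of _ 4])
  have "\<bar>centred_cos w \<alpha> i x * centred_cos w \<beta> j x\<bar> \<le> 2 * 2" for x
    unfolding abs_mult by (intro mult_mono abs_centred_cos_le) auto
  then show "AE x in M. norm (centred_cos w \<alpha> i x * centred_cos w \<beta> j x) \<le> 4" by simp
qed (use assms in auto)

text \<open>Polarisation of the product reduces the mean to those of sums and differences. This form
  separates a part even in the correlation, hence of second order, from an odd part of first order
  that disappears unless both phases have nonzero sine.\<close>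

lemma covariance_cos:
  assumes ij: "i < d" "j < d"
  shows "expectation (\<lambda>x. centred_cos w \<alpha> i x * centred_cos w \<beta> j x)
    = exp (- w\<^sup>2) * (cos \<alpha> * cos \<beta> * (cosh (w\<^sup>2 * \<rho> i j) - 1) + sin \<alpha> * sin \<beta> * sinh (w\<^sup>2 * \<rho> i j))"
proof -
  define e where "e = exp (- w\<^sup>2 / 2)"
  define E where "E = exp (- w\<^sup>2)"
  define P where "P = exp (w\<^sup>2 * \<rho> i j)"
  define Q where "Q = exp (- (w\<^sup>2 * \<rho> i j))"
  have ee: "e * e = E" by (simp add: e_def E_def exp_add[symmetric])
  have "centred_cos w \<alpha> i x * centred_cos w \<beta> j x
     = cos ((\<alpha> + \<beta>) + w * (X i x + X j x)) / 2 + cos ((\<alpha> - \<beta>) + w * (X i x - X j x)) / 2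
      - e * cos \<beta> * cos (\<alpha> + w * X i x) - e * cos \<alpha> * cos (\<beta> + w * X j x) + e * e * cos \<alpha> * cos \<beta>" for x
  proof -
    have 1: "(\<alpha> + \<beta>) + w * (X i x + X j x) = (\<alpha> + w * X i x) + (\<beta> + w * X j x)"
      and 2: "(\<alpha> - \<beta>) + w * (X i x - X j x) = (\<alpha> + w * X i x) - (\<beta> + w * X j x)"
      by (simp_all add: algebra_simps)
    have 3: "cos (a + b) / 2 + cos (a - b) / 2 = cos a * cos b" for a b :: real
      by (simp add: cos_add cos_diff field_simps)
    show ?thesis
      unfolding 1 2 3 centred_cos_def e_def[symmetric] by (simp add: algebra_simps)
  qed
  then have "expectation (\<lambda>x. centred_cos w \<alpha> i x * centred_cos w \<beta> j x)
     = cos (\<alpha> + \<beta>) * exp (- w\<^sup>2 * (1 + \<rho> i j)) / 2 + cos (\<alpha> - \<beta>) * exp (- w\<^sup>2 * (1 - \<rho> i j)) / 2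
      - e * cos \<beta> * (cos \<alpha> * e) - e * cos \<alpha> * (cos \<beta> * e) + e * e * cos \<alpha> * cos \<beta>"
    using ij by (simp add: integrable_cos_X integrable_cos_comb expectation_cos expectation_cos_add
        expectation_cos_diff prob_space e_def)
  also have "exp (- w\<^sup>2 * (1 + \<rho> i j)) = E * Q"
    by (simp add: E_def Q_def exp_add[symmetric] algebra_simps)
  also have "exp (- w\<^sup>2 * (1 - \<rho> i j)) = E * P"
    by (simp add: E_def P_def exp_add[symmetric] algebra_simps)
  finally have *: "expectation (\<lambda>x. centred_cos w \<alpha> i x * centred_cos w \<beta> j x)
     = cos (\<alpha> + \<beta>) * (E * Q) / 2 + cos (\<alpha> - \<beta>) * (E * P) / 2 - (e * e) * cos \<alpha> * cos \<beta>"
    by (simp add: algebra_simps)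
  have ch: "cosh (w\<^sup>2 * \<rho> i j) = (P + Q) / 2" "sinh (w\<^sup>2 * \<rho> i j) = (P - Q) / 2"
    by (simp_all add: cosh_def sinh_def P_def Q_def)
  show ?thesis
    unfolding * ee ch E_def[symmetric] by (simp add: cos_add cos_diff field_simps)
qed

text \<open>Once \<open>sinh_mult_le\<close> has extracted the correlation, the factor
  \<open>exp (- w\<^sup>2)\<close> absorbs the growth of the hyperbolic functions, so the bound is
  uniform in the frequency.\<close>

lemma covariance_cos_le:
  assumes ij: "i < d" "j < d"
  shows "expectation (\<lambda>x. centred_cos w \<alpha> i x * centred_cos w \<beta> j x)
    \<le> (\<rho> i j)\<^sup>2 + \<bar>sin \<alpha>\<bar> * \<bar>sin \<beta>\<bar> * \<bar>\<rho> i j\<bar>"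
proof -
  define q where "q = w\<^sup>2"
  define r where "r = \<bar>\<rho> i j\<bar>"
  have q: "q \<ge> 0" and r: "0 \<le> r" "r \<le> 1" using abs_corr_le_1[OF ij] by (auto simp: q_def r_def)
  have r2: "r\<^sup>2 = (\<rho> i j)\<^sup>2" by (simp add: r_def)
  have sinh_le_exp: "sinh y \<le> exp y" if "y \<ge> 0" for y :: real
    unfolding sinh_def using exp_gt_zero[of y] exp_gt_zero[of "-y"] by (simp del: exp_gt_zero)
  \<comment> \<open>This identity makes the quadratic estimate for \<open>cosh\<close> follow from
    the linear one for \<open>sinh\<close>.\<close>
  have cosh_eq: "cosh y - 1 = 2 * (sinh (y / 2))\<^sup>2" for y :: real
    using cosh_double[of "y/2"] cosh_square_eq[of "y/2"] by simp
  have abs_sinh: "\<bar>sinh (q * \<rho> i j)\<bar> = sinh (r * q)"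
    using q by (cases "\<rho> i j \<ge> 0") (auto simp: r_def mult.commute abs_of_nonneg abs_of_nonpos mult_nonneg_nonpos)
  have c: "cosh (q * \<rho> i j) = cosh (r * q)"
    by (cases "\<rho> i j \<ge> 0") (auto simp: r_def mult.commute)
  have "sinh (r * (q / 2)) \<le> r * sinh (q / 2)" using sinh_mult_le[of r "q/2"] q r by simp
  then have "(sinh (r * q / 2))\<^sup>2 \<le> (r * sinh (q / 2))\<^sup>2"
    using q r by (intro power_mono) auto
  then have "cosh (r * q) - 1 \<le> r\<^sup>2 * (cosh q - 1)"
    unfolding cosh_eq by (simp add: power_mult_distrib)
  moreover have "exp (- q) * (cosh q - 1) \<le> 1"
  proof -
    have "cosh q \<le> exp q" unfolding cosh_def using q by simp
    then have "cosh q - 1 \<le> exp q" by simp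
    then have "exp (- q) * (cosh q - 1) \<le> exp (- q) * exp q" by (intro mult_left_mono) auto
    then show ?thesis by (simp add: exp_minus)
  qed
  ultimately have A: "exp (- q) * (cosh (r * q) - 1) \<le> r\<^sup>2"
  proof -
    assume h: "cosh (r * q) - 1 \<le> r\<^sup>2 * (cosh q - 1)" "exp (- q) * (cosh q - 1) \<le> 1"
    have "exp (- q) * (cosh (r * q) - 1) \<le> exp (-q) * (r\<^sup>2 * (cosh q - 1))"
      using h by (intro mult_left_mono) auto
    also have "\<dots> = r\<^sup>2 * (exp (-q) * (cosh q - 1))" by simp
    also have "\<dots> \<le> r\<^sup>2 * 1" using h by (intro mult_left_mono) auto
    finally show ?thesis by simp
  qed
  have B: "exp (- q) * sinh (r * q) \<le> r"
  proof -
    have "sinh (r * q) \<le> r * sinh q" using sinh_mult_le[of r q] q r by simp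
    also have "\<dots> \<le> r * exp q" using r q sinh_le_exp by (intro mult_left_mono) auto
    finally have "exp (-q) * sinh (r * q) \<le> exp (-q) * (r * exp q)" by (intro mult_left_mono) auto
    then show ?thesis using exp_minus_inverse[of q] by (simp add: mult.left_commute mult.commute)
  qed
  have "expectation (\<lambda>x. centred_cos w \<alpha> i x * centred_cos w \<beta> j x)
      = (cos \<alpha> * cos \<beta>) * (exp (-q) * (cosh (r * q) - 1)) + sin \<alpha> * sin \<beta> * (exp (-q) * sinh (q * \<rho> i j))"
    unfolding covariance_cos[OF ij] q_def[symmetric] c by (simp add: algebra_simps)
  also have "\<dots> \<le> 1 * (exp (-q) * (cosh (r * q) - 1)) + \<bar>sin \<alpha>\<bar> * \<bar>sin \<beta>\<bar> * (exp (-q) * sinh (r * q))"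
  proof (intro add_mono mult_right_mono)
    have "\<bar>cos \<alpha> * cos \<beta>\<bar> \<le> 1" unfolding abs_mult by (intro mult_le_one) auto
    then show "cos \<alpha> * cos \<beta> \<le> 1" by linarith
    show "0 \<le> exp (-q) * (cosh (r * q) - 1)" by (simp add: cosh_real_ge_1)
    have "sin \<alpha> * sin \<beta> * (exp (-q) * sinh (q * \<rho> i j)) \<le> \<bar>sin \<alpha> * sin \<beta> * (exp (-q) * sinh (q * \<rho> i j))\<bar>" by simp
    also have "\<dots> = \<bar>sin \<alpha>\<bar> * \<bar>sin \<beta>\<bar> * (exp (-q) * sinh (r * q))"
      by (simp add: abs_mult abs_sinh)
    finally show "sin \<alpha> * sin \<beta> * (exp (-q) * sinh (q * \<rho> i j)) \<le> \<bar>sin \<alpha>\<bar> * \<bar>sin \<beta>\<bar> * (exp (-q) * sinh (r * q))" .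
  qed
  also have "\<dots> \<le> r\<^sup>2 + \<bar>sin \<alpha>\<bar> * \<bar>sin \<beta>\<bar> * r"
    using A B by (intro add_mono mult_left_mono) auto
  finally show ?thesis unfolding r2 by (simp add: r_def)
qed

section \<open>Moments of squares of the coordinates\<close>

lemma expectation_X_pow2: "i < d \<Longrightarrow> expectation (\<lambda>x. (X i x)\<^sup>2) = 1"
  by (subst integral_X[where f="\<lambda>z. z\<^sup>2"]) (auto simp: std_normal_integral_pow2)

lemma integrable_X_pow2_mult:
  assumes "i < d" "j < d"
  shows "integrable M (\<lambda>x. (X i x)\<^sup>2 * (X j x)\<^sup>2)"
proof (rule Bochner_Integration.integrable_bound)
  show "integrable M (\<lambda>x. X i x ^ 4 + X j x ^ 4)"
    using assms by (intro Bochner_Integration.integrable_add integrable_X_power)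
  show "AE x in M. norm ((X i x)\<^sup>2 * (X j x)\<^sup>2) \<le> norm (X i x ^ 4 + X j x ^ 4)"
  proof (intro AE_I2)
    fix x
    define a where "a = (X i x)\<^sup>2"
    define b where "b = (X j x)\<^sup>2"
    have ab: "0 \<le> a * b" by (simp add: a_def b_def)
    moreover have "a * b \<le> a\<^sup>2 + b\<^sup>2"
      using sum_squares_bound[of a b] ab by linarith
    moreover have "X i x ^ 4 = a\<^sup>2" "X j x ^ 4 = b\<^sup>2" by (simp_all add: a_def b_def)
    ultimately show "norm ((X i x)\<^sup>2 * (X j x)\<^sup>2) \<le> norm (X i x ^ 4 + X j x ^ 4)"
      unfolding a_def[symmetric] b_def[symmetric] by simp
  qed
qed (use assms in measurable)

text \<open>A case of Isserlis' formula, by polarisation: the fourth moments of the sum and of the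
  difference are known, and the odd mixed terms cancel when the two are added.\<close>

lemma expectation_X_pow2_mult:
  assumes ij: "i < d" "j < d"
  shows "expectation (\<lambda>x. (X i x)\<^sup>2 * (X j x)\<^sup>2) = 1 + 2 * (\<rho> i j)\<^sup>2"
proof -
  have pol: "(X i x + X j x) ^ 4 + (X i x - X j x) ^ 4
      = 2 * X i x ^ 4 + 12 * ((X i x)\<^sup>2 * (X j x)\<^sup>2) + 2 * X j x ^ 4" for x
    by (simp add: power4_eq_xxxx power2_eq_square algebra_simps)
  have p: "2 + 2 * \<rho> i j \<ge> 0" "2 - 2 * \<rho> i j \<ge> 0"
    using abs_corr_le_1[OF ij] by (auto simp: abs_le_iff)
  have s4: "sqrt a ^ 4 = a\<^sup>2" if "a \<ge> 0" for a
    using that by (simp add: power4_eq_xxxx power2_eq_square)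
  have int: "integrable M (\<lambda>x. (X i x + X j x) ^ 4)" "integrable M (\<lambda>x. (X i x - X j x) ^ 4)"
    using integrable_distr_eq[of "\<lambda>x. X i x + X j x" M borel "\<lambda>z. z ^ 4"] ij
      integrable_distr_eq[of "\<lambda>x. X i x - X j x" M borel "\<lambda>z. z ^ 4"]
    by (simp_all add: distr_add distr_diff integrable_distr_eq power_mult_distrib
        integrable_std_normal_distribution_moment)
  have "expectation (\<lambda>x. (X i x + X j x) ^ 4 + (X i x - X j x) ^ 4)
     = 3 * (2 + 2 * \<rho> i j)\<^sup>2 + 3 * (2 - 2 * \<rho> i j)\<^sup>2"
    using int expectation_add_X[OF _ ij, of "\<lambda>z. z ^ 4"] expectation_diff_X[OF _ ij, of "\<lambda>z. z ^ 4"] p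
    by (simp add: power_mult_distrib std_normal_integral_pow4 s4)
  moreover have "expectation (\<lambda>x. (X i x + X j x) ^ 4 + (X i x - X j x) ^ 4)
     = 2 * 3 + 12 * expectation (\<lambda>x. (X i x)\<^sup>2 * (X j x)\<^sup>2) + 2 * 3"
    unfolding pol using ij integral_X[of "\<lambda>z. z ^ 4" i] integral_X[of "\<lambda>z. z ^ 4" j]
    by (simp add: integrable_X_power integrable_X_pow2_mult std_normal_integral_pow4)
  ultimately show ?thesis by (simp add: power2_eq_square algebra_simps)
qed

section \<open>Second moments of sums over coordinates\<close>

lemma square_sum_integral:
  fixes f :: "nat \<Rightarrow> 'a \<Rightarrow> real"
  assumes "\<And>i j. i \<in> I \<Longrightarrow> j \<in> I \<Longrightarrow> integrable M (\<lambda>x. f i x * f j x)"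
  shows "integrable M (\<lambda>x. (\<Sum>i\<in>I. f i x)\<^sup>2)"
    and "expectation (\<lambda>x. (\<Sum>i\<in>I. f i x)\<^sup>2) = (\<Sum>i\<in>I. \<Sum>j\<in>I. expectation (\<lambda>x. f i x * f j x))"
proof -
  have "(\<Sum>i\<in>I. f i x)\<^sup>2 = (\<Sum>i\<in>I. \<Sum>j\<in>I. f i x * f j x)" for x
    by (simp add: power2_eq_square sum_product)
  then show "integrable M (\<lambda>x. (\<Sum>i\<in>I. f i x)\<^sup>2)"
    and "expectation (\<lambda>x. (\<Sum>i\<in>I. f i x)\<^sup>2) = (\<Sum>i\<in>I. \<Sum>j\<in>I. expectation (\<lambda>x. f i x * f j x))"
    using assms by simp_all
qed

definition frob :: real where "frob = sqrt (\<Sum>i<d. \<Sum>j<d. (\<rho> i j)\<^sup>2)"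

lemma frob_sq: "frob\<^sup>2 = (\<Sum>i<d. \<Sum>j<d. (\<rho> i j)\<^sup>2)"
  unfolding frob_def by (intro real_sqrt_pow2 sum_nonneg) auto

lemma frob_nonneg: "frob \<ge> 0"
  unfolding frob_def by (intro real_sqrt_ge_zero sum_nonneg) auto

lemma sum_corr_sq_le:
  assumes "I \<subseteq> {..<d}"
  shows "(\<Sum>i\<in>I. \<Sum>j\<in>I. (\<rho> i j)\<^sup>2) \<le> frob\<^sup>2"
proof -
  have "(\<Sum>i\<in>I. \<Sum>j\<in>I. (\<rho> i j)\<^sup>2) \<le> (\<Sum>i\<in>I. \<Sum>j<d. (\<rho> i j)\<^sup>2)"
    using assms by (intro sum_mono sum_mono2) auto
  also have "\<dots> \<le> (\<Sum>i<d. \<Sum>j<d. (\<rho> i j)\<^sup>2)"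
    using assms by (intro sum_mono2) (auto intro: sum_nonneg)
  finally show ?thesis by (simp add: frob_sq)
qed

text \<open>Cauchy-Schwarz over the pairs in \<open>I \<times> I\<close> against the constant 1.
  Applied to the outliers it bounds the part of the variance that is linear in the
  correlations.\<close>

lemma sum_abs_corr_le:
  assumes I: "I \<subseteq> {..<d}"
  shows "(\<Sum>i\<in>I. \<Sum>j\<in>I. \<bar>\<rho> i j\<bar>) \<le> real (card I) * frob"
proof -
  have "(\<Sum>p\<in>I\<times>I. \<bar>\<rho> (fst p) (snd p)\<bar> * 1)\<^sup>2
      \<le> (\<Sum>p\<in>I\<times>I. \<bar>\<rho> (fst p) (snd p)\<bar>\<^sup>2) * (\<Sum>p\<in>I\<times>I. 1\<^sup>2)"
    by (rule Cauchy_Schwarz_ineq_sum)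
  also have "(\<Sum>p\<in>I\<times>I. \<bar>\<rho> (fst p) (snd p)\<bar>\<^sup>2) = (\<Sum>i\<in>I. \<Sum>j\<in>I. (\<rho> i j)\<^sup>2)"
    by (simp add: sum.cartesian_product split_def)
  also have "(\<Sum>p\<in>I\<times>I. 1\<^sup>2) = (real (card I))\<^sup>2"
    by (simp add: card_cartesian_product power2_eq_square)
  also have "(\<Sum>p\<in>I\<times>I. \<bar>\<rho> (fst p) (snd p)\<bar> * 1) = (\<Sum>i\<in>I. \<Sum>j\<in>I. \<bar>\<rho> i j\<bar>)"
    by (simp add: sum.cartesian_product split_def)
  finally have "(\<Sum>i\<in>I. \<Sum>j\<in>I. \<bar>\<rho> i j\<bar>)\<^sup>2 \<le> (\<Sum>i\<in>I. \<Sum>j\<in>I. (\<rho> i j)\<^sup>2) * (real (card I))\<^sup>2" .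
  also have "\<dots> \<le> frob\<^sup>2 * (real (card I))\<^sup>2"
    using sum_corr_sq_le[OF I] by (intro mult_right_mono) auto
  finally have "(\<Sum>i\<in>I. \<Sum>j\<in>I. \<bar>\<rho> i j\<bar>)\<^sup>2 \<le> (real (card I) * frob)\<^sup>2"
    by (simp add: power_mult_distrib mult.commute)
  then show ?thesis by (rule power2_le_imp_le) (simp add: frob_nonneg)
qed

text \<open>The part linear in \<rho> carries the sines of both phases, so it is restricted to
  indices with nonzero phase before Cauchy-Schwarz is used. If all phases vanish, only
  \<open>frob\<^sup>2\<close> remains.\<close>

lemma second_moment_centred_cos:
  assumes I: "I \<subseteq> {..<d}"
  shows "integrable M (\<lambda>x. (\<Sum>i\<in>I. centred_cos w (\<alpha> i) i x)\<^sup>2)"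
    and "expectation (\<lambda>x. (\<Sum>i\<in>I. centred_cos w (\<alpha> i) i x)\<^sup>2)
      \<le> frob\<^sup>2 + real (card {i\<in>I. \<alpha> i \<noteq> 0}) * frob"
proof -
  note sq = square_sum_integral[of I "\<lambda>i. centred_cos w (\<alpha> i) i"]
  let ?S = "{i\<in>I. \<alpha> i \<noteq> 0}"
  have fin: "finite I" using I finite_subset by auto
  show "integrable M (\<lambda>x. (\<Sum>i\<in>I. centred_cos w (\<alpha> i) i x)\<^sup>2)"
    using I by (intro sq integrable_centred_cos_mult) auto
  have "expectation (\<lambda>x. (\<Sum>i\<in>I. centred_cos w (\<alpha> i) i x)\<^sup>2)
      = (\<Sum>i\<in>I. \<Sum>j\<in>I. expectation (\<lambda>x. centred_cos w (\<alpha> i) i x * centred_cos w (\<alpha> j) j x))"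
    using I by (intro sq integrable_centred_cos_mult) auto
  also have "\<dots> \<le> (\<Sum>i\<in>I. \<Sum>j\<in>I. (\<rho> i j)\<^sup>2 + \<bar>sin (\<alpha> i)\<bar> * \<bar>sin (\<alpha> j)\<bar> * \<bar>\<rho> i j\<bar>)"
    using I by (intro sum_mono covariance_cos_le) auto
  also have "\<dots> = (\<Sum>i\<in>I. \<Sum>j\<in>I. (\<rho> i j)\<^sup>2) + (\<Sum>i\<in>I. \<Sum>j\<in>I. \<bar>sin (\<alpha> i)\<bar> * \<bar>sin (\<alpha> j)\<bar> * \<bar>\<rho> i j\<bar>)"
    by (simp add: sum.distrib)
  also have "(\<Sum>i\<in>I. \<Sum>j\<in>I. \<bar>sin (\<alpha> i)\<bar> * \<bar>sin (\<alpha> j)\<bar> * \<bar>\<rho> i j\<bar>)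
     = (\<Sum>i\<in>?S. \<Sum>j\<in>I. \<bar>sin (\<alpha> i)\<bar> * \<bar>sin (\<alpha> j)\<bar> * \<bar>\<rho> i j\<bar>)"
    using fin by (intro sum.mono_neutral_right) auto
  also have "\<dots> = (\<Sum>i\<in>?S. \<Sum>j\<in>?S. \<bar>sin (\<alpha> i)\<bar> * \<bar>sin (\<alpha> j)\<bar> * \<bar>\<rho> i j\<bar>)"
    using fin by (intro sum.cong refl sum.mono_neutral_right) auto
  also have "\<dots> \<le> (\<Sum>i\<in>?S. \<Sum>j\<in>?S. \<bar>\<rho> i j\<bar>)"
    by (intro sum_mono mult_left_le_one_le mult_le_one) auto
  also have "\<dots> \<le> real (card ?S) * frob"
    using I by (intro sum_abs_corr_le) auto
  also have "(\<Sum>i\<in>I. \<Sum>j\<in>I. (\<rho> i j)\<^sup>2) \<le> frob\<^sup>2"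
    by (rule sum_corr_sq_le[OF I])
  finally show "expectation (\<lambda>x. (\<Sum>i\<in>I. centred_cos w (\<alpha> i) i x)\<^sup>2)
      \<le> frob\<^sup>2 + real (card {i\<in>I. \<alpha> i \<noteq> 0}) * frob" by simp
qed

text \<open>A crude bound that uses only correlations of modulus at most 1. It controls the size of
  \<open>t_hat\<close> on the bad event.\<close>

lemma second_moment_sum_squares:
  assumes I: "I \<subseteq> {..<d}"
  shows "integrable M (\<lambda>x. (\<Sum>i\<in>I. (X i x)\<^sup>2)\<^sup>2)"
    and "expectation (\<lambda>x. (\<Sum>i\<in>I. (X i x)\<^sup>2)\<^sup>2) \<le> 3 * (real d)\<^sup>2"
proof -
  note sq = square_sum_integral[of I "\<lambda>i x. (X i x)\<^sup>2"]
  show "integrable M (\<lambda>x. (\<Sum>i\<in>I. (X i x)\<^sup>2)\<^sup>2)"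
    using I by (intro sq integrable_X_pow2_mult) auto
  have "expectation (\<lambda>x. (\<Sum>i\<in>I. (X i x)\<^sup>2)\<^sup>2)
      = (\<Sum>i\<in>I. \<Sum>j\<in>I. expectation (\<lambda>x. (X i x)\<^sup>2 * (X j x)\<^sup>2))"
    using I by (intro sq integrable_X_pow2_mult) auto
  also have "\<dots> = (\<Sum>i\<in>I. \<Sum>j\<in>I. 1 + 2 * (\<rho> i j)\<^sup>2)"
    using I by (intro sum.cong refl expectation_X_pow2_mult) auto
  also have "\<dots> \<le> (\<Sum>i\<in>I. \<Sum>j\<in>I. 3)"
  proof (intro sum_mono)
    fix i j assume "i \<in> I" "j \<in> I"
    then have "(\<rho> i j)\<^sup>2 \<le> 1" using abs_corr_le_1 I by (auto simp: abs_square_le_1)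
    then show "1 + 2 * (\<rho> i j)\<^sup>2 \<le> 3" by simp
  qed
  also have "\<dots> = 3 * (real (card I))\<^sup>2" by (simp add: power2_eq_square)
  also have "\<dots> \<le> 3 * (real d)\<^sup>2"
    using card_mono[OF _ I] by (intro mult_left_mono power_mono) auto
  finally show "expectation (\<lambda>x. (\<Sum>i\<in>I. (X i x)\<^sup>2)\<^sup>2) \<le> 3 * (real d)\<^sup>2" .
qed

text \<open>Two squares have covariance twice the squared correlation, without a linear term. This
  keeps the average squared noise near 1 and thereby bounds \<open>t_hat\<close> from above on the
  good event.\<close>

lemma second_moment_centred_squares:
  assumes I: "I \<subseteq> {..<d}"
  shows "integrable M (\<lambda>x. (\<Sum>i\<in>I. (X i x)\<^sup>2 - 1)\<^sup>2)"
    and "expectation (\<lambda>x. (\<Sum>i\<in>I. (X i x)\<^sup>2 - 1)\<^sup>2) \<le> 2 * frob\<^sup>2"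
proof -
  note sq = square_sum_integral[of I "\<lambda>i x. (X i x)\<^sup>2 - 1"]
  have eq: "((X i x)\<^sup>2 - 1) * ((X j x)\<^sup>2 - 1) = (X i x)\<^sup>2 * (X j x)\<^sup>2 - (X i x)\<^sup>2 - (X j x)\<^sup>2 + 1" for i j x
    by (simp add: algebra_simps)
  have int: "integrable M (\<lambda>x. ((X i x)\<^sup>2 - 1) * ((X j x)\<^sup>2 - 1))" if "i < d" "j < d" for i j
    unfolding eq using that by (simp add: integrable_X_pow2_mult integrable_X_power)
  have ex: "expectation (\<lambda>x. ((X i x)\<^sup>2 - 1) * ((X j x)\<^sup>2 - 1)) = 2 * (\<rho> i j)\<^sup>2" if "i < d" "j < d" for i j
    unfolding eq using that
    by (simp add: integrable_X_pow2_mult integrable_X_power expectation_X_pow2_mult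
        expectation_X_pow2 prob_space)
  show "integrable M (\<lambda>x. (\<Sum>i\<in>I. (X i x)\<^sup>2 - 1)\<^sup>2)"
    using I by (intro sq int) auto
  have "expectation (\<lambda>x. (\<Sum>i\<in>I. (X i x)\<^sup>2 - 1)\<^sup>2)
      = (\<Sum>i\<in>I. \<Sum>j\<in>I. expectation (\<lambda>x. ((X i x)\<^sup>2 - 1) * ((X j x)\<^sup>2 - 1)))"
    using I by (intro sq int) auto
  also have "\<dots> = (\<Sum>i\<in>I. \<Sum>j\<in>I. 2 * (\<rho> i j)\<^sup>2)"
    using I by (intro sum.cong refl ex) auto
  also have "\<dots> = 2 * (\<Sum>i\<in>I. \<Sum>j\<in>I. (\<rho> i j)\<^sup>2)" by (simp add: sum_distrib_left)
  also have "\<dots> \<le> 2 * frob\<^sup>2" using sum_corr_sq_le[OF I] by simp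
  finally show "expectation (\<lambda>x. (\<Sum>i\<in>I. (X i x)\<^sup>2 - 1)\<^sup>2) \<le> 2 * frob\<^sup>2" .
qed

end

section \<open>The chi-squared distribution function\<close>

lemma measure_std_normal_le:
  assumes A: "A \<in> sets borel" "emeasure lborel A = ennreal m" "0 \<le> m" "0 \<le> c"
    and dens: "\<And>z. z \<in> A \<Longrightarrow> std_normal_density z \<le> c"
  shows "measure std_normal_distribution A \<le> c * m"
proof -
  have "emeasure std_normal_distribution A
      = (\<integral>\<^sup>+ z. ennreal (std_normal_density z) * indicator A z \<partial>lborel)"
    using A by (intro emeasure_density) auto
  also have "\<dots> \<le> (\<integral>\<^sup>+ z. ennreal c * indicator A z \<partial>lborel)"
    using dens by (intro nn_integral_mono) (auto simp: indicator_def intro: ennreal_leI)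
  also have "\<dots> = ennreal (c * m)"
    using A by (simp add: nn_integral_cmult_indicator ennreal_mult)
  finally show ?thesis
    unfolding measure_def using A by (intro enn2real_leI) auto
qed

lemma measure_std_normal_ge:
  assumes A: "A \<in> sets borel" "emeasure lborel A = ennreal m" "0 \<le> m" "0 \<le> c"
    and dens: "\<And>z. z \<in> A \<Longrightarrow> c \<le> std_normal_density z"
  shows "c * m \<le> measure std_normal_distribution A"
proof -
  interpret N: real_distribution std_normal_distribution by (rule real_dist_normal_dist)
  have "ennreal (c * m) = (\<integral>\<^sup>+ z. ennreal c * indicator A z \<partial>lborel)"
    using A by (simp add: nn_integral_cmult_indicator ennreal_mult)
  also have "\<dots> \<le> (\<integral>\<^sup>+ z. ennreal (std_normal_density z) * indicator A z \<partial>lborel)"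
    using dens by (intro nn_integral_mono) (auto simp: indicator_def intro: ennreal_leI)
  also have "\<dots> = emeasure std_normal_distribution A"
    using A by (intro emeasure_density[symmetric]) auto
  finally show ?thesis
    by (simp add: N.emeasure_eq_measure)
qed

text \<open>The constant follows from \<pi> > 3 and stays below 1/2, so an interval of unit length
  has mass bounded away from one half.\<close>

lemma std_normal_density_le: "std_normal_density z \<le> 9/20"
proof -
  have "(20/9)\<^sup>2 \<le> (2 * pi :: real)" using pi_gt3 by (simp add: power2_eq_square)
  then have "20/9 \<le> sqrt (2 * pi)" by (rule real_le_rsqrt)
  then have "1 / sqrt (2 * pi) \<le> 9/20" by (simp add: field_simps)
  moreover have "exp (- z\<^sup>2 / 2) \<le> 1" by simp
  ultimately have "1 / sqrt (2 * pi) * exp (- z\<^sup>2 / 2) \<le> 9/20 * 1"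
    by (intro mult_mono) auto
  then show ?thesis by (simp add: std_normal_density_def)
qed

lemma chi2_1_cdf_eq: "0 \<le> r \<Longrightarrow> chi2_1_cdf (r\<^sup>2) = measure std_normal_distribution {- r..r}"
  unfolding chi2_1_cdf_def by (intro arg_cong[where f="measure _"]) (auto simp: abs_le_square_iff[symmetric])

lemma chi2_1_cdf_mono: "x \<le> y \<Longrightarrow> chi2_1_cdf x \<le> chi2_1_cdf y"
proof -
  interpret N: real_distribution std_normal_distribution by (rule real_dist_normal_dist)
  show "x \<le> y \<Longrightarrow> chi2_1_cdf x \<le> chi2_1_cdf y"
    unfolding chi2_1_cdf_def by (intro N.finite_measure_mono) auto
qed

lemma chi2_1_cdf_diff:
  assumes "0 \<le> \<alpha>" "\<alpha> \<le> \<beta>"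
  shows "chi2_1_cdf (\<beta>\<^sup>2) - chi2_1_cdf (\<alpha>\<^sup>2) = measure std_normal_distribution ({- \<beta>..\<beta>} - {- \<alpha>..\<alpha>})"
    and "emeasure lborel ({- \<beta>..\<beta>} - {- \<alpha>..\<alpha>}) = ennreal (2 * (\<beta> - \<alpha>))"
proof -
  interpret N: real_distribution std_normal_distribution by (rule real_dist_normal_dist)
  show "chi2_1_cdf (\<beta>\<^sup>2) - chi2_1_cdf (\<alpha>\<^sup>2) = measure std_normal_distribution ({- \<beta>..\<beta>} - {- \<alpha>..\<alpha>})"
    using assms by (subst N.finite_measure_Diff) (auto simp: chi2_1_cdf_eq)
  show "emeasure lborel ({- \<beta>..\<beta>} - {- \<alpha>..\<alpha>}) = ennreal (2 * (\<beta> - \<alpha>))"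
    using assms by (subst emeasure_Diff) (auto simp: ennreal_minus algebra_simps)
qed

text \<open>Two intervals of length \<beta> - \<alpha> are added, on which the density is below 1/2;
  as a function of the square root of its argument, the c.d.f. is thus Lipschitz with constant
  1.\<close>

lemma chi2_1_cdf_diff_le:
  assumes "0 \<le> \<alpha>" "\<alpha> \<le> \<beta>"
  shows "chi2_1_cdf (\<beta>\<^sup>2) - chi2_1_cdf (\<alpha>\<^sup>2) \<le> \<beta> - \<alpha>"
proof -
  have "chi2_1_cdf (\<beta>\<^sup>2) - chi2_1_cdf (\<alpha>\<^sup>2) \<le> 9/20 * (2 * (\<beta> - \<alpha>))"
    unfolding chi2_1_cdf_diff(1)[OF assms] using assms chi2_1_cdf_diff(2)[OF assms] std_normal_density_le
    by (intro measure_std_normal_le) auto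
  then show ?thesis using assms by simp
qed

text \<open>On the two added intervals the density is smallest at the outer radius \<beta>.\<close>

lemma chi2_1_cdf_diff_ge:
  assumes "0 \<le> \<alpha>" "\<alpha> \<le> \<beta>"
  shows "2 * std_normal_density \<beta> * (\<beta> - \<alpha>) \<le> chi2_1_cdf (\<beta>\<^sup>2) - chi2_1_cdf (\<alpha>\<^sup>2)"
proof -
  have "std_normal_density \<beta> * (2 * (\<beta> - \<alpha>)) \<le> chi2_1_cdf (\<beta>\<^sup>2) - chi2_1_cdf (\<alpha>\<^sup>2)"
    unfolding chi2_1_cdf_diff(1)[OF assms]
  proof (rule measure_std_normal_ge)
    fix z assume "z \<in> {- \<beta>..\<beta>} - {- \<alpha>..\<alpha>}"
    then have "z\<^sup>2 \<le> \<beta>\<^sup>2" using assms by (auto simp: abs_le_square_iff[symmetric])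
    then show "std_normal_density \<beta> \<le> std_normal_density z"
      by (simp add: std_normal_density_def divide_right_mono)
  qed (use assms chi2_1_cdf_diff(2)[OF assms] in auto)
  then show ?thesis by (simp add: algebra_simps)
qed

lemma chi2_1_cdf_0: "chi2_1_cdf 0 = 0"
proof -
  have "chi2_1_cdf (0\<^sup>2) = measure std_normal_distribution {0}"
    by (subst chi2_1_cdf_eq) auto
  also have "\<dots> \<le> 9/20 * 0"
    by (rule measure_std_normal_le) (auto intro: std_normal_density_le simp del: divide_le_eq_numeral1 le_divide_eq_numeral1)
  finally show ?thesis by (simp add: chi2_1_cdf_def measure_le_0_iff)
qed

text \<open>The margin of 1/20 below the median level later absorbs the error of the empirical
  c.d.f., which forces \<open>t_hat\<close> above \<open>\<sigma>\<^sup>2 / 4\<close>.\<close>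

lemma chi2_1_cdf_quarter_le: "chi2_1_cdf (1/4) \<le> 9/20"
proof -
  have "chi2_1_cdf ((1/2)\<^sup>2) = measure std_normal_distribution {- (1/2)..1/2}"
    by (rule chi2_1_cdf_eq) simp
  also have "\<dots> \<le> 9/20 * 1"
    by (rule measure_std_normal_le) (auto intro: std_normal_density_le simp del: divide_le_eq_numeral1 le_divide_eq_numeral1)
  finally show ?thesis by (simp add: power2_eq_square)
qed

lemma chi2_1_cdf_strict_mono:
  assumes "0 \<le> x" "x < y"
  shows "chi2_1_cdf x < chi2_1_cdf y"
proof -
  have "0 < 2 * std_normal_density (sqrt y) * (sqrt y - sqrt x)"
    using assms by (intro mult_pos_pos) (auto simp: normal_density_pos)
  also have "\<dots> \<le> chi2_1_cdf ((sqrt y)\<^sup>2) - chi2_1_cdf ((sqrt x)\<^sup>2)"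
    using assms by (intro chi2_1_cdf_diff_ge) auto
  finally show ?thesis using assms by simp
qed

text \<open>Markov's inequality for the square, whose mean is 1.\<close>

lemma std_normal_tail_le:
  assumes "0 < x"
  shows "measure std_normal_distribution {z. x < z\<^sup>2} \<le> 1 / x"
proof -
  interpret N: real_distribution std_normal_distribution by (rule real_dist_normal_dist)
  have int: "integrable std_normal_distribution (\<lambda>z. z\<^sup>2 / x)"
    using integrable_std_normal_distribution_moment[of 2] by simp
  have "measure std_normal_distribution {z. x < z\<^sup>2}
     = (\<integral>z. indicator {z. x < z\<^sup>2} z \<partial>std_normal_distribution)"
    by simp
  also have "\<dots> \<le> (\<integral>z. z\<^sup>2 / x \<partial>std_normal_distribution)"
    using assms int by (intro integral_mono) (auto simp: N.emeasure_eq_measure split: split_indicator)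
  also have "\<dots> = 1 / x" by (simp add: std_normal_integral_pow2)
  finally show ?thesis .
qed

lemma chi2_1_cdf_ge:
  assumes "0 < x"
  shows "1 - 1 / x \<le> chi2_1_cdf x"
proof -
  interpret N: real_distribution std_normal_distribution by (rule real_dist_normal_dist)
  have "chi2_1_cdf x = 1 - measure std_normal_distribution {z. x < z\<^sup>2}"
    unfolding chi2_1_cdf_def using N.prob_compl[of "{z. x < z\<^sup>2}"]
    by (simp add: Compl_eq_Diff_UNIV[symmetric] Collect_neg_eq[symmetric] not_less)
  then show ?thesis using std_normal_tail_le[OF assms] by simp
qed

lemma continuous_on_chi2_1_cdf_square: "continuous_on {0..b} (\<lambda>r. chi2_1_cdf (r\<^sup>2))"
proof (rule continuous_onI)
  fix x e :: real assume x: "x \<in> {0..b}" and e: "0 < e"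
  have "dist (chi2_1_cdf (y\<^sup>2)) (chi2_1_cdf (x\<^sup>2)) \<le> e" if y: "y \<in> {0..b}" "dist y x < e" for y
  proof (cases "x \<le> y")
    case True
    then show ?thesis
      using chi2_1_cdf_diff_le[of x y] chi2_1_cdf_mono[of "x\<^sup>2" "y\<^sup>2"] x y by (auto simp: dist_real_def power_mono)
  next
    case False
    then show ?thesis
      using chi2_1_cdf_diff_le[of y x] chi2_1_cdf_mono[of "y\<^sup>2" "x\<^sup>2"] x y by (auto simp: dist_real_def power_mono)
  qed
  then show "\<exists>d>0. \<forall>x'\<in>{0..b}. dist x' x < d \<longrightarrow> dist (chi2_1_cdf (x'\<^sup>2)) (chi2_1_cdf (x\<^sup>2)) \<le> e"
    using e by blast
qed

text \<open>Existence comes from the intermediate value theorem and uniqueness from strict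
  monotonicity, so the definite description denotes the inverse for 0 < p < 1.\<close>

lemma chi2_1_quantile:
  assumes "0 < p" "p < 1"
  shows "0 \<le> chi2_1_quantile p" and "chi2_1_cdf (chi2_1_quantile p) = p"
proof -
  \<comment> \<open>Chosen so that the lower bound \<open>1 - 1 / b\<^sup>2\<close> for the c.d.f.
    at \<open>b\<^sup>2\<close> equals \<open>p\<close>.\<close>
  define b where "b = sqrt (1 / (1 - p))"
  have b: "0 \<le> b" "b\<^sup>2 = 1 / (1 - p)" using assms by (auto simp: b_def)
  have "p \<le> chi2_1_cdf (b\<^sup>2)"
    using chi2_1_cdf_ge[of "1 / (1 - p)"] assms by (simp add: b)
  moreover have "chi2_1_cdf (0\<^sup>2) \<le> p" using assms by (simp add: chi2_1_cdf_0)
  ultimately obtain r where "0 \<le> r" "chi2_1_cdf (r\<^sup>2) = p"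
    using IVT'[of "\<lambda>r. chi2_1_cdf (r\<^sup>2)" 0 p b] b continuous_on_chi2_1_cdf_square by auto
  then have "\<exists>x. 0 \<le> x \<and> chi2_1_cdf x = p" by (intro exI[of _ "r\<^sup>2"]) auto
  moreover have "x = y" if "0 \<le> x \<and> chi2_1_cdf x = p" "0 \<le> y \<and> chi2_1_cdf y = p" for x y
    using that chi2_1_cdf_strict_mono[of x y] chi2_1_cdf_strict_mono[of y x] by (cases x y rule: linorder_cases) auto
  ultimately have "\<exists>!x. 0 \<le> x \<and> chi2_1_cdf x = p" by blast
  then have "0 \<le> chi2_1_quantile p \<and> chi2_1_cdf (chi2_1_quantile p) = p"
    unfolding chi2_1_quantile_def by (rule theI')
  then show "0 \<le> chi2_1_quantile p" "chi2_1_cdf (chi2_1_quantile p) = p" by auto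
qed

lemma chi2_1_quantile_gt:
  assumes "1/2 \<le> p" "p < 1"
  shows "1/4 < chi2_1_quantile p"
proof (rule ccontr)
  assume "\<not> ?thesis"
  then have "chi2_1_cdf (chi2_1_quantile p) \<le> chi2_1_cdf (1/4)" by (intro chi2_1_cdf_mono) auto
  then show False using chi2_1_quantile(2)[of p] chi2_1_cdf_quarter_le assms by simp
qed

lemma chi2_1_quantile_le:
  assumes "0 < p" "p < 1" "0 \<le> x" "p \<le> chi2_1_cdf x"
  shows "chi2_1_quantile p \<le> x"
  using chi2_1_cdf_strict_mono[of x "chi2_1_quantile p"] chi2_1_quantile[of p] assms by force

lemma chi2_1_cdf_less_1: "chi2_1_cdf x < 1"
proof -
  interpret N: real_distribution std_normal_distribution by (rule real_dist_normal_dist)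
  have "chi2_1_cdf x \<le> chi2_1_cdf \<bar>x\<bar>" by (intro chi2_1_cdf_mono) auto
  also have "\<dots> < chi2_1_cdf (\<bar>x\<bar> + 1)" by (intro chi2_1_cdf_strict_mono) auto
  also have "\<dots> \<le> 1" unfolding chi2_1_cdf_def by (rule N.prob_le_1)
  finally show ?thesis .
qed

text \<open>The smallest density in range is at \<open>sqrt (2 * b)\<close> and the shortest
  increment of the radius is at \<open>a\<close>. The gap leaves room for the error of the empirical
  c.d.f. and makes twice the plug-in variance at least \<open>\<sigma>\<^sup>2\<close>.\<close>

lemma chi2_1_cdf_doubling_gap:
  assumes "0 < a" "a \<le> b"
  obtains \<delta> where "0 < \<delta>" "\<And>x. a \<le> x \<Longrightarrow> x \<le> b \<Longrightarrow> chi2_1_cdf x + \<delta> \<le> chi2_1_cdf (2 * x)"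
proof
  define \<delta> where "\<delta> = 2 * std_normal_density (sqrt (2 * b)) * ((sqrt 2 - 1) * sqrt a)"
  show "0 < \<delta>" using assms by (auto simp: \<delta>_def intro!: mult_pos_pos normal_density_pos)
  fix x assume x: "a \<le> x" "x \<le> b"
  have "std_normal_density (sqrt (2 * b)) \<le> std_normal_density (sqrt (2 * x))"
    using x assms by (simp add: std_normal_density_def divide_right_mono)
  moreover have "(sqrt 2 - 1) * sqrt a \<le> (sqrt 2 - 1) * sqrt x"
    using x by (intro mult_left_mono) auto
  ultimately have "\<delta> \<le> 2 * std_normal_density (sqrt (2 * x)) * ((sqrt 2 - 1) * sqrt x)"
    using assms unfolding \<delta>_def by (intro mult_mono) auto
  also have "(sqrt 2 - 1) * sqrt x = sqrt (2 * x) - sqrt x"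
    by (simp add: real_sqrt_mult algebra_simps)
  also have "2 * std_normal_density (sqrt (2 * x)) * (sqrt (2 * x) - sqrt x)
      \<le> chi2_1_cdf ((sqrt (2 * x))\<^sup>2) - chi2_1_cdf ((sqrt x)\<^sup>2)"
    using x assms by (intro chi2_1_cdf_diff_ge) auto
  finally show "chi2_1_cdf x + \<delta> \<le> chi2_1_cdf (2 * x)"
    using x assms by simp
qed

section \<open>Trigonometric majorants of an interval\<close>

lemma polynomial_in_cos_expansion:
  fixes a :: "nat \<Rightarrow> real"
  obtains \<gamma> where "\<And>\<theta>. (\<Sum>i\<le>n. a i * cos \<theta> ^ i) = (\<Sum>j\<le>n. \<gamma> j * cos (real j * \<theta>))"
proof -
  obtain \<beta> :: "nat \<Rightarrow> nat \<Rightarrow> real" where \<beta>: "\<And>k \<theta>. cos \<theta> ^ k = (\<Sum>j\<le>k. \<beta> k j * cos (real j * \<theta>))"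
    using trig_power_expansion by metis
  show ?thesis
  proof
    fix \<theta> :: real
    have "(\<Sum>i\<le>n. a i * cos \<theta> ^ i) = (\<Sum>i\<le>n. \<Sum>j\<le>n. if j \<le> i then a i * \<beta> i j * cos (real j * \<theta>) else 0)"
    proof (intro sum.cong refl)
      fix i assume i: "i \<in> {..n}"
      have "a i * cos \<theta> ^ i = (\<Sum>j\<le>i. a i * \<beta> i j * cos (real j * \<theta>))"
        by (simp add: \<beta> sum_distrib_left mult.assoc)
      also have "\<dots> = (\<Sum>j\<le>n. if j \<le> i then a i * \<beta> i j * cos (real j * \<theta>) else 0)"
        using i by (intro sum.mono_neutral_cong_left) auto
      finally show "a i * cos \<theta> ^ i = (\<Sum>j\<le>n. if j \<le> i then a i * \<beta> i j * cos (real j * \<theta>) else 0)" .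
    qed
    also have "\<dots> = (\<Sum>j\<le>n. \<Sum>i\<le>n. if j \<le> i then a i * \<beta> i j * cos (real j * \<theta>) else 0)"
      by (rule sum.swap)
    also have "\<dots> = (\<Sum>j\<le>n. (\<Sum>i\<le>n. if j \<le> i then a i * \<beta> i j else 0) * cos (real j * \<theta>))"
      unfolding sum_distrib_right by (intro sum.cong refl) auto
    finally show "(\<Sum>i\<le>n. a i * cos \<theta> ^ i)
      = (\<Sum>j\<le>n. (\<Sum>i\<le>n. if j \<le> i then a i * \<beta> i j else 0) * cos (real j * \<theta>))" .
  qed
qed

text \<open>
  The frequencies scale with \<open>1 / sqrt x\<close>, so one polynomial in the cosine serves all \<open>x\<close>. The majorant is
  periodic; choosing \<open>w\<close> small pushes its spurious periods into the tail of the normal distribution.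
\<close>

lemma trig_majorant_of_interval:
  fixes a b \<delta> :: real
  assumes ab: "0 < a" "a \<le> b" and \<delta>: "0 < \<delta>"
  obtains n :: nat and \<gamma> :: "nat \<Rightarrow> real" and w :: real where
    "\<And>x z. a \<le> x \<Longrightarrow> x \<le> b \<Longrightarrow>
       (if z\<^sup>2 \<le> x then 1 else 0) \<le> (\<Sum>j\<le>n. \<gamma> j * cos (real j * w / sqrt x * z))"
    "\<And>x. a \<le> x \<Longrightarrow> x \<le> b \<Longrightarrow>
       (\<Sum>j\<le>n. \<gamma> j * exp (- (real j * w / sqrt x)\<^sup>2 / 2)) \<le> chi2_1_cdf x + \<delta>"
proof -
  interpret N: real_distribution std_normal_distribution by (rule real_dist_normal_dist)
  \<comment> \<open>Relative widening of the interval on which the ramp descends; by the Lipschitz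
    bound it costs at most \<delta> / 4 in the c.d.f.\<close>
  define \<eta> where "\<eta> = min 1 (\<delta> / (4 * sqrt b))"
  have \<eta>: "0 < \<eta>" "\<eta> \<le> 1" "\<eta> * sqrt b \<le> \<delta> / 4"
    using ab \<delta> by (auto simp: \<eta>_def min_def field_simps)
  \<comment> \<open>By the tail bound, the mass where the angle exceeds 1 is at most
    \<open>w\<^sup>2 / a\<close>, hence at most \<delta> / 4.\<close>
  define w where "w = min 1 (sqrt (a * \<delta>) / 2)"
  have w: "0 < w" "w \<le> 1" using ab \<delta> by (auto simp: w_def)
  have "w\<^sup>2 \<le> (sqrt (a * \<delta>) / 2)\<^sup>2" using w by (intro power_mono) (auto simp: w_def)
  then have w2: "w\<^sup>2 / a \<le> \<delta> / 4" using ab \<delta> by (simp add: power_divide field_simps)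
  have le_pi: "(1 + \<eta>) * w \<le> pi"
  proof -
    have "(1 + \<eta>) * w \<le> 2 * 1" using \<eta> w by (intro mult_mono) auto
    then show ?thesis using pi_gt3 by linarith
  qed
  define u v where "u = cos w" and "v = cos ((1 + \<eta>) * w)"
  have uv: "v < u"
    unfolding u_def v_def using w \<eta> le_pi by (intro cos_monotone_0_pi) auto
  \<comment> \<open>A ramp in the cosine: it is 1 at angles up to \<open>w\<close> and 0 at angles
    from \<open>(1 + \<eta>) * w\<close> to \<pi>.\<close>
  define h where "h c = max 0 (min 1 ((c - v) / (u - v)))" for c :: real
  have cont: "continuous_on {-1..1} h"
    unfolding h_def using uv by (intro continuous_intros) auto
  obtain P where "real_polynomial_function P" and P: "\<And>c. c \<in> {-1..1} \<Longrightarrow> \<bar>h c - P c\<bar> < \<delta> / 4"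
    using Stone_Weierstrass_real_polynomial_function[OF compact_Icc cont, of "\<delta> / 4"] \<delta> by auto
  then obtain p n where p: "P = (\<lambda>c. \<Sum>i\<le>n. p i * c ^ i)"
    using real_polynomial_function_iff_sum by auto
  \<comment> \<open>Raising the approximant by its error \<delta> / 4 turns it into a majorant of
    \<open>h\<close> that exceeds \<open>h\<close> by at most \<delta> / 2.\<close>
  define q where "q i = p i + (if i = 0 then \<delta> / 4 else 0)" for i :: nat
  have q: "(\<Sum>i\<le>n. q i * c ^ i) = P c + \<delta> / 4" for c
    unfolding p q_def by (simp add: distrib_right sum.distrib if_distrib[where f="\<lambda>x. x * _"] sum.delta cong: if_cong)
  obtain \<gamma> where \<gamma>: "\<And>\<theta>. (\<Sum>i\<le>n. q i * cos \<theta> ^ i) = (\<Sum>j\<le>n. \<gamma> j * cos (real j * \<theta>))"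
    using polynomial_in_cos_expansion[where a=q and n=n] by blast
  have G: "(\<Sum>j\<le>n. \<gamma> j * cos (real j * w / sqrt x * z)) = P (cos (w * z / sqrt x)) + \<delta> / 4" for x z
    using \<gamma>[of "w * z / sqrt x"] q[of "cos (w * z / sqrt x)"] by (simp add: mult.assoc)
  have bnd: "h (cos t) \<le> P (cos t) + \<delta> / 4" "P (cos t) + \<delta> / 4 \<le> h (cos t) + \<delta> / 2" for t
    using P[of "cos t"] unfolding abs_less_iff by (auto simp: field_simps)
  show ?thesis
  proof (rule that[where w=w and n=n and \<gamma>=\<gamma>])
    fix x z :: real assume x: "a \<le> x" "x \<le> b"
    have sx: "0 < sqrt x" using x ab by simp
    have "(if z\<^sup>2 \<le> x then 1 else 0) \<le> h (cos (w * z / sqrt x))"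
    proof (cases "z\<^sup>2 \<le> x")
      case True
      then have "\<bar>z\<bar> \<le> sqrt x" by (simp add: real_le_rsqrt)
      then have "\<bar>w * z / sqrt x\<bar> \<le> w" using w sx by (simp add: abs_mult field_simps)
      then have "cos w \<le> cos \<bar>w * z / sqrt x\<bar>"
        using w pi_gt3 by (intro cos_monotone_0_pi_le) auto
      then have "u \<le> cos (w * z / sqrt x)" unfolding u_def cos_abs_real .
      then have "1 \<le> (cos (w * z / sqrt x) - v) / (u - v)" using uv by (simp add: field_simps)
      then show ?thesis by (simp add: h_def True)
    qed (simp add: h_def)
    then show "(if z\<^sup>2 \<le> x then 1 else 0) \<le> (\<Sum>j\<le>n. \<gamma> j * cos (real j * w / sqrt x * z))"
      unfolding G using bnd(1)[of "w * z / sqrt x"] by simp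
  next
    fix x :: real assume x: "a \<le> x" "x \<le> b"
    have sx: "0 < sqrt x" "0 < x" using x ab by auto
    let ?A = "{z. z\<^sup>2 \<le> ((1 + \<eta>) * sqrt x)\<^sup>2}"
    \<comment> \<open>Outside \<open>?B\<close> the angle is at most 1, where the cosine is still
      monotone; inside, periodicity may lift the ramp again and it is bounded by 1.\<close>
    let ?B = "{z. x / w\<^sup>2 < z\<^sup>2}"
    have h_le: "h (cos (w * z / sqrt x)) \<le> indicator ?A z + indicator ?B z" for z
    proof (cases "z \<in> ?A \<or> z \<in> ?B")
      case True
      moreover have "h (cos (w * z / sqrt x)) \<le> 1" by (simp add: h_def)
      ultimately show ?thesis by (auto simp: indicator_def)
    next
      case False
      then have z: "(1 + \<eta>) * sqrt x < \<bar>z\<bar>" "z\<^sup>2 \<le> x / w\<^sup>2"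
        using \<eta> sx by (auto simp: abs_le_square_iff[symmetric] abs_mult not_le)
      have "(w * z / sqrt x)\<^sup>2 \<le> 1"
        using z w sx by (simp add: power_mult_distrib power_divide field_simps)
      then have "\<bar>w * z / sqrt x\<bar> \<le> 1" by (simp add: abs_square_le_1)
      moreover have "(1 + \<eta>) * w \<le> \<bar>w * z / sqrt x\<bar>"
      proof -
        have "(1 + \<eta>) * w = w * ((1 + \<eta>) * sqrt x) / sqrt x" using sx by simp
        also have "\<dots> \<le> w * \<bar>z\<bar> / sqrt x" using z w sx by (intro divide_right_mono mult_left_mono) auto
        finally show ?thesis using w sx by (simp add: abs_mult)
      qed
      ultimately have "cos \<bar>w * z / sqrt x\<bar> \<le> cos ((1 + \<eta>) * w)"
        using w \<eta> pi_gt3 by (intro cos_monotone_0_pi_le) auto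
      then have "(cos (w * z / sqrt x) - v) / (u - v) \<le> 0"
        unfolding cos_abs_real using uv by (simp add: v_def divide_nonpos_pos)
      then have "h (cos (w * z / sqrt x)) = 0" by (simp add: h_def)
      then show ?thesis by simp
    qed
    let ?g = "\<lambda>z. \<Sum>j\<le>n. \<gamma> j * cos (real j * w / sqrt x * z)"
    have int_cos: "integrable std_normal_distribution (\<lambda>z. cos (c * z))" for c
      by (rule N.integrable_const_bound[of _ 1]) auto
    have int_sum: "integrable std_normal_distribution (\<lambda>z. \<Sum>j\<le>n. \<gamma> j * cos (c j * z))"
      "(\<integral>z. (\<Sum>j\<le>n. \<gamma> j * cos (c j * z)) \<partial>std_normal_distribution) = (\<Sum>j\<le>n. \<gamma> j * exp (- (c j)\<^sup>2 / 2))" for c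
      using std_normal_integral_cos[of 0] int_cos by simp_all
    have "(\<Sum>j\<le>n. \<gamma> j * exp (- (real j * w / sqrt x)\<^sup>2 / 2)) = (\<integral>z. ?g z \<partial>std_normal_distribution)"
      by (rule int_sum(2)[symmetric])
    also have "\<dots> \<le> (\<integral>z. indicator ?A z + indicator ?B z + \<delta> / 2 \<partial>std_normal_distribution)"
    proof (rule integral_mono)
      show "integrable std_normal_distribution ?g" by (rule int_sum(1))
      show "integrable std_normal_distribution (\<lambda>z. indicator ?A z + indicator ?B z + \<delta> / 2)"
        by (intro Bochner_Integration.integrable_add) (auto simp: N.emeasure_eq_measure)
      show "?g z \<le> indicator ?A z + indicator ?B z + \<delta> / 2" for z
        unfolding G using bnd(2)[of "w * z / sqrt x"] h_le[of z] by linarith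
    qed
    also have "\<dots> = measure std_normal_distribution ?A + measure std_normal_distribution ?B + \<delta> / 2"
      by (subst Bochner_Integration.integral_add)
        (auto simp: N.emeasure_eq_measure N.prob_space[simplified])
    also have "measure std_normal_distribution ?B \<le> 1 / (x / w\<^sup>2)"
      using w sx by (intro std_normal_tail_le) auto
    also have "1 / (x / w\<^sup>2) \<le> w\<^sup>2 / a" using x ab by (simp add: divide_left_mono)
    also have "w\<^sup>2 / a \<le> \<delta> / 4" by (rule w2)
    also have "measure std_normal_distribution ?A = chi2_1_cdf (((1 + \<eta>) * sqrt x)\<^sup>2)"
      by (simp add: chi2_1_cdf_def)
    also have "\<dots> \<le> chi2_1_cdf x + \<delta> / 4"
    proof -
      have "chi2_1_cdf (((1 + \<eta>) * sqrt x)\<^sup>2) - chi2_1_cdf ((sqrt x)\<^sup>2) \<le> (1 + \<eta>) * sqrt x - sqrt x"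
        using \<eta> sx by (intro chi2_1_cdf_diff_le) (auto simp: distrib_right)
      also have "\<dots> = \<eta> * sqrt x" by (simp add: algebra_simps)
      also have "\<dots> \<le> \<eta> * sqrt b" using \<eta> x by (intro mult_left_mono) auto
      finally show ?thesis using \<eta>(3) sx by simp
    qed
    finally show "(\<Sum>j\<le>n. \<gamma> j * exp (- (real j * w / sqrt x)\<^sup>2 / 2)) \<le> chi2_1_cdf x + \<delta>"
      by simp
  qed
qed

section \<open>The estimator for a fixed observation\<close>

lemma emp_cdf_mono: "t \<le> t' \<Longrightarrow> emp_cdf d \<Sigma> Y t \<le> emp_cdf d \<Sigma> Y t'"
  unfolding emp_cdf_def by (intro divide_right_mono of_nat_mono card_mono) auto

text \<open>At small levels only exact zeros are counted, so the set of admissible exponents is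
  bounded below and its infimum is a minimum. Minimality yields the bound at half the level.\<close>

lemma t_hat_properties:
  assumes d: "1 \<le> d" and zeros: "2 * card {i\<in>{..<d}. Ytil \<Sigma> Y i = 0} < d"
  obtains l :: int where "t_hat d \<Sigma> Y = 2 powr real_of_int l"
    "1/2 \<le> emp_cdf d \<Sigma> Y (2 powr real_of_int l)" "emp_cdf d \<Sigma> Y (2 powr real_of_int l / 2) < 1/2"
proof -
  define G where "G l = emp_cdf d \<Sigma> Y (2 powr real_of_int l)" for l :: int
  define L where "L = {l. G l \<ge> 1/2}"
  have mono: "G l \<le> G l'" if "l \<le> l'" for l l'
    unfolding G_def using that by (intro emp_cdf_mono powr_mono) auto
  define mx where "mx = Max ((\<lambda>i. (Ytil \<Sigma> Y i)\<^sup>2) ` {..<d})"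
  have mx: "(Ytil \<Sigma> Y i)\<^sup>2 \<le> mx" if "i < d" for i
    unfolding mx_def using that by (intro Max_ge) auto
  define l1 where "l1 = \<lceil>log 2 (max 1 mx)\<rceil>"
  have "log 2 (max 1 mx) \<le> real_of_int l1" by (simp add: l1_def)
  then have "max 1 mx \<le> 2 powr real_of_int l1" by (subst (asm) log_le_iff) auto
  then have l1: "(Ytil \<Sigma> Y i)\<^sup>2 \<le> 2 powr real_of_int l1" if "i < d" for i using mx[OF that] by simp
  have "G l1 = 1"
  proof -
    have "{i\<in>{..<d}. (Ytil \<Sigma> Y i)\<^sup>2 \<le> 2 powr real_of_int l1} = {..<d}" using l1 by auto
    then show ?thesis using d by (simp add: G_def emp_cdf_def)
  qed
  then have l1L: "l1 \<in> L" by (simp add: L_def)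
  \<comment> \<open>Inserting 1 gives \<open>Min\<close> a nonempty set of positive numbers without
    a case distinction.\<close>
  define mn where "mn = Min (insert 1 ((\<lambda>i. (Ytil \<Sigma> Y i)\<^sup>2) ` {i\<in>{..<d}. Ytil \<Sigma> Y i \<noteq> 0}))"
  have mn: "mn \<le> (Ytil \<Sigma> Y i)\<^sup>2" if "i < d" "Ytil \<Sigma> Y i \<noteq> 0" for i
    unfolding mn_def using that by (intro Min_le) auto
  have mn0: "0 < mn" unfolding mn_def by (subst Min_gr_iff) auto
  \<comment> \<open>Subtracting 1 makes the power strictly smaller than \<open>mn\<close>.\<close>
  define l0 where "l0 = \<lfloor>log 2 mn\<rfloor> - 1"
  have "real_of_int l0 < log 2 mn" unfolding l0_def by linarith
  then have l0: "2 powr real_of_int l0 < mn" using mn0 by (subst (asm) less_log_iff) auto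
  have "G l0 < 1/2"
  proof -
    have "{i\<in>{..<d}. (Ytil \<Sigma> Y i)\<^sup>2 \<le> 2 powr real_of_int l0} \<subseteq> {i\<in>{..<d}. Ytil \<Sigma> Y i = 0}"
      using l0 mn by force
    then have "card {i\<in>{..<d}. (Ytil \<Sigma> Y i)\<^sup>2 \<le> 2 powr real_of_int l0} \<le> card {i\<in>{..<d}. Ytil \<Sigma> Y i = 0}"
      by (intro card_mono) auto
    then have "2 * card {i\<in>{..<d}. (Ytil \<Sigma> Y i)\<^sup>2 \<le> 2 powr real_of_int l0} < d" using zeros by linarith
    then have "2 * real (card {i\<in>{..<d}. (Ytil \<Sigma> Y i)\<^sup>2 \<le> 2 powr real_of_int l0}) < real d" by linarith
    then show ?thesis using d by (simp add: G_def emp_cdf_def field_simps)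
  qed
  then have lower: "l0 < l" if "l \<in> L" for l
    using mono[of l l0] that by (force simp: L_def)
  define l where "l = Min (L \<inter> {l0..l1})"
  have fin: "finite (L \<inter> {l0..l1})" "L \<inter> {l0..l1} \<noteq> {}" using l1L lower[OF l1L] by auto
  have lL: "l \<in> L" using Min_in[OF fin] by (auto simp: l_def)
  have lmin: "l \<le> l'" if "l' \<in> L" for l'
  proof (cases "l' \<le> l1")
    case True
    then show ?thesis unfolding l_def using fin that lower[OF that] by (intro Min_le) auto
  next
    case False
    moreover have "l \<le> l1" unfolding l_def using fin l1L lower[OF l1L] by (intro Min_le) auto
    ultimately show ?thesis by simp
  qed
  show ?thesis
  proof (rule that[of l])
    have "Inf L = l" using lL lmin by (intro cInf_eq_minimum) auto
    then show "t_hat d \<Sigma> Y = 2 powr real_of_int l" by (simp only: t_hat_def L_def G_def)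
    show "1/2 \<le> emp_cdf d \<Sigma> Y (2 powr real_of_int l)" using lL by (simp add: L_def G_def)
    have "\<not> l - 1 \<in> L" using lmin[of "l - 1"] by auto
    moreover have "2 powr real_of_int (l - 1) = 2 powr real_of_int l / 2" by (simp add: powr_diff)
    ultimately show "emp_cdf d \<Sigma> Y (2 powr real_of_int l / 2) < 1/2" by (simp only: L_def G_def mem_Collect_eq not_le)
  qed
qed

text \<open>A counting form of Markov's inequality: more than half of the coordinates exceed the
  level and at most a tenth are outliers, so at least 2/5 of all coordinates are noise coordinates
  exceeding it.\<close>

lemma emp_cdf_less_half_imp_le:
  assumes d: "1 \<le> d" and t: "0 \<le> t" and less: "emp_cdf d \<Sigma> Y t < 1/2"
    and N: "N \<subseteq> {..<d}" "real (card ({..<d} - N)) \<le> real d / 10"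
    and y: "\<And>i. i \<in> N \<Longrightarrow> Ytil \<Sigma> Y i = \<sigma> * x i"
  shows "t \<le> 5/2 * \<sigma>\<^sup>2 * ((\<Sum>i\<in>N. (x i)\<^sup>2) / real d)"
proof -
  define A where "A = {i\<in>{..<d}. (Ytil \<Sigma> Y i)\<^sup>2 \<le> t}"
  have finN: "finite N" using N(1) finite_subset by auto
  have A: "real (card A) < real d / 2"
    using less d by (simp add: emp_cdf_def A_def field_simps)
  have "card {..<d} \<le> card ((({..<d} - N) \<union> A) \<union> (N - A))"
    using N(1) finN by (intro card_mono) (auto simp: A_def)
  also have "\<dots> \<le> (card ({..<d} - N) + card A) + card (N - A)"
    by (meson add_le_mono1 card_Un_le order_trans)
  finally have "real d \<le> real (card ({..<d} - N)) + real (card A) + real (card (N - A))"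
    by simp
  then have B: "2/5 * real d \<le> real (card (N - A))" using A N(2) by linarith
  have "2/5 * real d * t \<le> real (card (N - A)) * t" using B t by (intro mult_right_mono) auto
  also have "\<dots> = (\<Sum>i\<in>N - A. t)" by simp
  also have "\<dots> \<le> (\<Sum>i\<in>N - A. \<sigma>\<^sup>2 * (x i)\<^sup>2)"
  proof (intro sum_mono)
    fix i assume i: "i \<in> N - A"
    then have "t < (Ytil \<Sigma> Y i)\<^sup>2" using N(1) by (auto simp: A_def)
    then show "t \<le> \<sigma>\<^sup>2 * (x i)\<^sup>2" using y[of i] i by (simp add: power_mult_distrib)
  qed
  also have "\<dots> \<le> (\<Sum>i\<in>N. \<sigma>\<^sup>2 * (x i)\<^sup>2)" using finN by (intro sum_mono2) auto
  also have "\<dots> = \<sigma>\<^sup>2 * (\<Sum>i\<in>N. (x i)\<^sup>2)" by (simp add: sum_distrib_left)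
  finally show ?thesis using d by (simp add: field_simps)
qed

text \<open>One \<delta> pays for counting every outlier, one for the deviations of the
  trigonometric averages weighted by the coefficients, and one for the excess mean of the
  majorant.\<close>

lemma emp_cdf_le_of_trig_averages:
  assumes d: "1 \<le> d" and \<sigma>: "0 < \<sigma>"
    and N: "N \<subseteq> {..<d}" "real (card ({..<d} - N)) \<le> \<delta> * real d"
    and y: "\<And>i. i \<in> N \<Longrightarrow> Ytil \<Sigma> Y i = \<sigma> * x i"
    and maj: "\<And>z. (if z\<^sup>2 \<le> \<xi> then 1 else 0) \<le> (\<Sum>j\<le>n. \<gamma> j * cos (c j * z))"
    and mean: "(\<Sum>j\<le>n. \<gamma> j * exp (- (c j)\<^sup>2 / 2)) \<le> chi2_1_cdf \<xi> + \<delta>"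
    and dev: "\<And>j. j \<le> n \<Longrightarrow> \<bar>(\<Sum>i\<in>N. cos (c j * x i) - exp (- (c j)\<^sup>2 / 2)) / real d\<bar> \<le> \<eta>"
    and \<eta>: "\<eta> * (\<Sum>j\<le>n. \<bar>\<gamma> j\<bar>) \<le> \<delta>"
  shows "emp_cdf d \<Sigma> Y (\<xi> * \<sigma>\<^sup>2) \<le> chi2_1_cdf \<xi> + 3 * \<delta>"
proof -
  define A where "A = {i\<in>{..<d}. (Ytil \<Sigma> Y i)\<^sup>2 \<le> \<xi> * \<sigma>\<^sup>2}"
  define B where "B = {i\<in>N. (x i)\<^sup>2 \<le> \<xi>}"
  define V where "V j = (\<Sum>i\<in>N. cos (c j * x i) - exp (- (c j)\<^sup>2 / 2)) / real d" for j
  have finN: "finite N" using N(1) finite_subset by auto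
  have \<delta>: "0 \<le> \<delta>" using N(2) d by (smt (verit) mult_nonneg_nonpos of_nat_0_le_iff of_nat_1 of_nat_mono zero_le_mult_iff)
  have cdf0: "0 \<le> chi2_1_cdf \<xi>" by (simp add: chi2_1_cdf_def)
  have "A \<subseteq> ({..<d} - N) \<union> B"
    using \<sigma> y by (auto simp: A_def B_def power_mult_distrib mult.commute)
  then have "card A \<le> card (({..<d} - N) \<union> B)"
    using finN by (intro card_mono) (auto simp: B_def)
  also have "\<dots> \<le> card ({..<d} - N) + card B" by (rule card_Un_le)
  finally have "real (card A) \<le> \<delta> * real d + real (card B)" using N(2) by linarith
  also have "real (card B) = (\<Sum>i\<in>N. if (x i)\<^sup>2 \<le> \<xi> then 1 else 0)"
    using finN by (simp add: B_def sum.inter_filter[symmetric])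
  also have "\<dots> \<le> (\<Sum>i\<in>N. \<Sum>j\<le>n. \<gamma> j * cos (c j * x i))"
    by (intro sum_mono maj)
  also have "\<dots> = (\<Sum>j\<le>n. \<gamma> j * (\<Sum>i\<in>N. cos (c j * x i)))"
    by (subst sum.swap) (simp add: sum_distrib_left)
  also have "\<dots> = (\<Sum>j\<le>n. \<gamma> j * (real d * V j + real (card N) * exp (- (c j)\<^sup>2 / 2)))"
    using d by (simp add: V_def sum_subtractf)
  also have "\<dots> = real d * (\<Sum>j\<le>n. \<gamma> j * V j) + real (card N) * (\<Sum>j\<le>n. \<gamma> j * exp (- (c j)\<^sup>2 / 2))"
    by (simp add: distrib_left sum.distrib sum_distrib_left mult_ac)
  also have "\<dots> \<le> real d * \<delta> + real d * (chi2_1_cdf \<xi> + \<delta>)"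
  proof (intro add_mono mult_left_mono)
    have "(\<Sum>j\<le>n. \<gamma> j * V j) \<le> (\<Sum>j\<le>n. \<bar>\<gamma> j\<bar> * \<eta>)"
    proof (intro sum_mono)
      fix j assume "j \<in> {..n}"
      then have "\<bar>V j\<bar> \<le> \<eta>" using dev by (simp add: V_def)
      then have "\<bar>\<gamma> j * V j\<bar> \<le> \<bar>\<gamma> j\<bar> * \<eta>" unfolding abs_mult by (intro mult_left_mono) auto
      then show "\<gamma> j * V j \<le> \<bar>\<gamma> j\<bar> * \<eta>" by linarith
    qed
    also have "\<dots> = \<eta> * (\<Sum>j\<le>n. \<bar>\<gamma> j\<bar>)" by (simp add: sum_distrib_left mult.commute)
    finally show "(\<Sum>j\<le>n. \<gamma> j * V j) \<le> \<delta>" using \<eta> by simp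
    have "real (card N) * (\<Sum>j\<le>n. \<gamma> j * exp (- (c j)\<^sup>2 / 2)) \<le> real (card N) * (chi2_1_cdf \<xi> + \<delta>)"
      using mean by (intro mult_left_mono) auto
    also have "\<dots> \<le> real d * (chi2_1_cdf \<xi> + \<delta>)"
      using card_mono[OF _ N(1)] cdf0 \<delta> by (intro mult_right_mono) auto
    finally show "real (card N) * (\<Sum>j\<le>n. \<gamma> j * exp (- (c j)\<^sup>2 / 2)) \<le> real d * (chi2_1_cdf \<xi> + \<delta>)" .
  qed auto
  finally have "real (card A) \<le> (chi2_1_cdf \<xi> + 3 * \<delta>) * real d" by (simp add: algebra_simps)
  then show ?thesis using d by (simp add: emp_cdf_def A_def pos_divide_le_eq)
qed

section \<open>Error of the estimator given the empirical characteristic function\<close>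

lemma abs_ln_one_plus_le:
  fixes r :: real
  assumes "\<bar>r\<bar> \<le> 1/2"
  shows "\<bar>ln (1 + r)\<bar> \<le> 2 * \<bar>r\<bar>"
proof -
  have "\<bar>ln (1 + r) - r\<bar> \<le> 2 * r\<^sup>2" using assms by (rule abs_ln_one_plus_x_minus_x_bound)
  moreover have "2 * r\<^sup>2 \<le> \<bar>r\<bar>"
  proof -
    have "\<bar>r\<bar> * \<bar>r\<bar> \<le> \<bar>r\<bar> * (1/2)" using assms by (intro mult_left_mono) auto
    then show ?thesis by (simp add: power2_eq_square)
  qed
  ultimately show ?thesis by linarith
qed

lemma abs_phi_hat_le: "\<bar>phi_hat d \<Sigma> Y u\<bar> \<le> 1"
proof (cases "d = 0")
  case False
  have "\<bar>\<Sum>i<d. cos (u * Ytil \<Sigma> Y i)\<bar> \<le> (\<Sum>i<d. \<bar>cos (u * Ytil \<Sigma> Y i)\<bar>)" by (rule sum_abs)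
  also have "\<dots> \<le> (\<Sum>i<d. 1)" by (intro sum_mono) auto
  finally show ?thesis using False by (simp add: phi_hat_def field_simps)
qed (simp add: phi_hat_def)

lemma lam_pos: "0 < lam d s \<Sigma>" unfolding lam_def by simp

text \<open>The truncation keeps the value finite even if \<open>phi_hat\<close> vanishes: the
  quantile exceeds 1/4 at levels of at least 1/2, so \<open>2 * sigmaS_hat_sq\<close> is at most
  \<open>8 * t_hat\<close>. Nonnegativity holds because \<open>phi_hat\<close> has modulus at most
  1.\<close>

lemma sigmaD_hat_sq_real:
  assumes half: "1/2 \<le> emp_cdf d \<Sigma> Y (t_hat d \<Sigma> Y)"
  obtains D where "sigmaD_hat_sq d s \<Sigma> Y = ereal D" "0 \<le> D" "D \<le> 8 * t_hat d \<Sigma> Y"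
    "ereal D = min (sigmaD_til_sq d s \<Sigma> Y) (2 * sigmaS_hat_sq d \<Sigma> Y)"
proof -
  define t where "t = t_hat d \<Sigma> Y"
  define p where "p = emp_cdf d \<Sigma> Y t"
  have t: "0 < t" by (simp add: t_def t_hat_def)
  have "\<exists>S. sigmaS_hat_sq d \<Sigma> Y = ereal S \<and> 0 \<le> S \<and> S \<le> 4 * t"
  proof (cases "p \<ge> 1")
    case True
    then show ?thesis using t by (auto simp: sigmaS_hat_sq_def sigmaS_sq_def t_def[symmetric] p_def[symmetric] zero_ereal_def)
  next
    case False
    then have q: "1/4 < chi2_1_quantile p" using half by (intro chi2_1_quantile_gt) (auto simp: p_def t_def)
    then have "t / chi2_1_quantile p \<le> 4 * t" using t by (simp add: field_simps)
    then show ?thesis using False half q t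
      by (intro exI[of _ "t / chi2_1_quantile p"])
        (auto simp: sigmaS_hat_sq_def sigmaS_sq_def t_def[symmetric] p_def[symmetric])
  qed
  then obtain S where S: "sigmaS_hat_sq d \<Sigma> Y = ereal S" "0 \<le> S" "S \<le> 4 * t" by blast
  have S2: "2 * sigmaS_hat_sq d \<Sigma> Y = ereal (2 * S)"
    unfolding S by (metis times_ereal.simps(1) numeral_eq_ereal)
  have D0: "0 \<le> sigmaD_til_sq d s \<Sigma> Y"
  proof (cases "phi_hat d \<Sigma> Y (sqrt (lam d s \<Sigma> / t)) = 0")
    case True
    then show ?thesis by (simp add: sigmaD_til_sq_def Let_def t_def)
  next
    case False
    have "ln \<bar>phi_hat d \<Sigma> Y (sqrt (lam d s \<Sigma> / t))\<bar> \<le> 0"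
      using False abs_phi_hat_le by (subst ln_le_zero_iff) auto
    then have "0 \<le> - (2 * t / lam d s \<Sigma>) * ln \<bar>phi_hat d \<Sigma> Y (sqrt (lam d s \<Sigma> / t))\<bar>"
      using t lam_pos[of d s \<Sigma>] by (intro mult_nonpos_nonpos) auto
    then show ?thesis using False by (simp add: sigmaD_til_sq_def Let_def t_def zero_ereal_def)
  qed
  define E where "E = sigmaD_hat_sq d s \<Sigma> Y"
  have "0 \<le> E" "E \<le> ereal (2 * S)" using D0 S by (auto simp: E_def sigmaD_hat_sq_def S2)
  then obtain D where "E = ereal D" "0 \<le> D" "D \<le> 2 * S" by (cases E) auto
  then show ?thesis using S by (intro that[of D]) (auto simp: E_def sigmaD_hat_sq_def t_def)
qed

lemma sigmaD_error_crude:
  assumes half: "1/2 \<le> emp_cdf d \<Sigma> Y (t_hat d \<Sigma> Y)" and v: "0 < v"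
  shows "real_of_ereal \<bar>sigmaD_hat_sq d s \<Sigma> Y - ereal v\<bar> \<le> v + 8 * t_hat d \<Sigma> Y"
proof -
  obtain D where D: "sigmaD_hat_sq d s \<Sigma> Y = ereal D" "0 \<le> D" "D \<le> 8 * t_hat d \<Sigma> Y"
    using sigmaD_hat_sq_real[OF half] by metis
  then show ?thesis using v by auto
qed

text \<open>Without \<open>R\<close> the logarithm returns exactly \<open>v\<close>, so the error is
  that of \<open>ln (1 + R)\<close>. The hypothesis \<open>cdf\<close> bounds the quantile by
  \<open>2 * t_hat / v\<close>, which places the truncation level above \<open>v\<close>.\<close>

lemma sigmaD_error_fine:
  assumes half: "1/2 \<le> emp_cdf d \<Sigma> Y (t_hat d \<Sigma> Y)" and v: "0 < v"
    and cdf: "emp_cdf d \<Sigma> Y (t_hat d \<Sigma> Y) \<le> chi2_1_cdf (2 * (t_hat d \<Sigma> Y / v))"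
    and R: "phi_hat d \<Sigma> Y (sqrt (lam d s \<Sigma> / t_hat d \<Sigma> Y)) = exp (- (lam d s \<Sigma> * v / t_hat d \<Sigma> Y) / 2) * (1 + R)"
      "\<bar>R\<bar> \<le> 1/2"
  shows "real_of_ereal \<bar>sigmaD_hat_sq d s \<Sigma> Y - ereal v\<bar> \<le> 4 * t_hat d \<Sigma> Y / lam d s \<Sigma> * \<bar>R\<bar>"
proof -
  define t where "t = t_hat d \<Sigma> Y"
  define l where "l = lam d s \<Sigma>"
  define p where "p = emp_cdf d \<Sigma> Y t"
  have t: "0 < t" by (simp add: t_def t_hat_def)
  have l: "0 < l" by (simp add: l_def lam_pos)
  obtain D where D: "sigmaD_hat_sq d s \<Sigma> Y = ereal D" "0 \<le> D"
    "ereal D = min (sigmaD_til_sq d s \<Sigma> Y) (2 * sigmaS_hat_sq d \<Sigma> Y)"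
    using sigmaD_hat_sq_real[OF half] by metis
  have p: "1/2 \<le> p" "p \<le> chi2_1_cdf (2 * (t / v))" using half cdf by (auto simp: p_def t_def)
  then have p1: "p < 1" using chi2_1_cdf_less_1[of "2 * (t / v)"] by linarith
  define q where "q = chi2_1_quantile p"
  have q: "0 < q" "q \<le> 2 * (t / v)"
    using chi2_1_quantile_gt[OF p(1) p1] chi2_1_quantile_le[of p "2 * (t / v)"] p p1 t v by (auto simp: q_def)
  have S: "2 * sigmaS_hat_sq d \<Sigma> Y = ereal (2 * (t / q))"
  proof -
    have "sigmaS_hat_sq d \<Sigma> Y = ereal (t / q)"
      using p p1 by (auto simp: sigmaS_hat_sq_def sigmaS_sq_def t_def[symmetric] p_def[symmetric] q_def)
    then show ?thesis by (metis times_ereal.simps(1) numeral_eq_ereal)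
  qed
  have S_ge: "v \<le> 2 * (t / q)" using q v t by (simp add: field_simps)
  have R1: "0 < 1 + R" using R(2) by (simp add: abs_le_iff)
  define T where "T = v - 2 * t / l * ln (1 + R)"
  have "\<bar>exp (- (l * v / t) / 2) * (1 + R)\<bar> = exp (- (l * v / t) / 2) * (1 + R)"
    using R1 by simp
  moreover have "ln (exp (- (l * v / t) / 2) * (1 + R)) = - (l * v / t) / 2 + ln (1 + R)"
    using R1 by (subst ln_mult) auto
  ultimately have "- (2 * t / l) * ln \<bar>exp (- (l * v / t) / 2) * (1 + R)\<bar> = T"
    using t l by (simp add: T_def) (simp add: field_simps)
  then have til: "sigmaD_til_sq d s \<Sigma> Y = ereal T"
    using R1 R(1) by (simp add: sigmaD_til_sq_def Let_def t_def[symmetric] l_def[symmetric])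
  have "D = min T (2 * (t / q))" using D(3) unfolding til S by (simp add: min_def split: if_splits)
  \<comment> \<open>If the truncation is active, the minimum lies between \<open>v\<close> and
    \<open>T\<close>, so it only reduces the error.\<close>
  then have "\<bar>D - v\<bar> \<le> \<bar>T - v\<bar>" using S_ge by (auto simp: min_def)
  also have "\<dots> = 2 * t / l * \<bar>ln (1 + R)\<bar>" using t l by (simp add: T_def abs_mult)
  also have "\<dots> \<le> 2 * t / l * (2 * \<bar>R\<bar>)"
    using t l abs_ln_one_plus_le[OF R(2)] by (intro mult_left_mono) auto
  finally show ?thesis unfolding D(1) t_def[symmetric] l_def[symmetric] by simp
qed

text \<open>The bias \<open>r\<close> is relative to \<open>e\<close> because each outlier's cosine
  has mean \<open>cos (u * \<tau> i) * e\<close>; every outlier changes the sum of the undamped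
  cosines by at most 2.\<close>

lemma phi_hat_decomposition:
  assumes d: "1 \<le> d" and e: "0 < e"
    and S: "real (card {i\<in>{..<d}. \<tau> i \<noteq> 0}) \<le> b * real d"
  obtains r where "\<bar>r\<bar> \<le> 2 * b"
    "(\<Sum>i<d. cos (u * \<tau> i + a i)) / real d
       = e * (1 + (r + (\<Sum>i<d. cos (u * \<tau> i + a i) - cos (u * \<tau> i) * e) / real d / e))"
proof -
  let ?S = "{i\<in>{..<d}. \<tau> i \<noteq> 0}"
  define r where "r = (\<Sum>i<d. cos (u * \<tau> i) - 1) / real d"
  have "(\<Sum>i<d. cos (u * \<tau> i) - 1) = (\<Sum>i\<in>?S. cos (u * \<tau> i) - 1)"
    by (intro sum.mono_neutral_right) auto
  then have "\<bar>\<Sum>i<d. cos (u * \<tau> i) - 1\<bar> \<le> (\<Sum>i\<in>?S. \<bar>cos (u * \<tau> i) - 1\<bar>)"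
    by (simp only: sum_abs)
  also have "\<dots> \<le> (\<Sum>i\<in>?S. 2)"
  proof (intro sum_mono)
    fix i show "\<bar>cos (u * \<tau> i) - 1\<bar> \<le> 2"
      using cos_ge_minus_one[of "u * \<tau> i"] cos_le_one[of "u * \<tau> i"] by linarith
  qed
  also have "\<dots> \<le> 2 * b * real d" using S by simp
  finally have "\<bar>r\<bar> \<le> 2 * b" using d by (simp add: r_def field_simps)
  moreover have "(\<Sum>i<d. cos (u * \<tau> i + a i)) / real d
       = e * (1 + (r + (\<Sum>i<d. cos (u * \<tau> i + a i) - cos (u * \<tau> i) * e) / real d / e))"
    using d e by (simp add: r_def sum_subtractf field_simps, simp add: sum_distrib_left)
  ultimately show ?thesis by (rule that)
qed

text \<open>
  The left-hand side of the third claim is the bound on the relative error in terms of the noise \<open>U\<close> of the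
  empirical characteristic function: the logarithm is linearised while \<open>\<bar>U\<bar> \<le> 1/4\<close>, and the error is at
  most \<open>321\<close> otherwise. The factor of \<open>b\<close> in the last claim bounds the second moment of \<open>U\<close>.
\<close>

lemma quadratic_majorant:
  fixes s d F L :: real
  assumes pos: "0 < s" "0 < d" "s \<le> d" "0 < F" and L: "L = max 1 (ln (s / F))"
  obtains a b where "0 \<le> a" "0 \<le> b"
    "\<And>U. 960 / L * (2 * (s / d) + \<bar>U\<bar>) + (if \<bar>U\<bar> > 1/4 then 321 else 0) \<le> a + b * U\<^sup>2"
    "a + b * (exp (2 * L / 3) * ((F\<^sup>2 + s * F) / d\<^sup>2)) \<le> 40000 * (s / (d * L) + F / d)"
proof (cases "ln (s / F) \<ge> 1")
  case True
  then have Leq: "L = ln (s / F)" and L1: "1 \<le> L" using L by auto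
  have sF: "s = F * exp L" using pos by (simp add: Leq)
  then have "F * 1 \<le> s" using pos L1 unfolding sF by (intro mult_left_mono) auto
  then have Fs: "F\<^sup>2 + s * F \<le> 2 * (s * F)" using pos by (simp add: power2_eq_square)
  define r where "r = s / d"
  have r: "0 < r" "r \<le> 1" using pos by (auto simp: r_def)
  define a where "a = 2400 * r / L"
  \<comment> \<open>The first term is the AM-GM inequality for the modulus of the noise with weight
    \<open>r\<close>; the second is 321 * 16, a Chebyshev bound for the indicator with threshold
    1/4.\<close>
  define b where "b = 480 / (r * L) + 5136"
  define B where "B = exp (2 * L / 3) * ((F\<^sup>2 + s * F) / d\<^sup>2)"
  have "B \<le> exp (2 * L / 3) * (2 * (s * F) / d\<^sup>2)"
    unfolding B_def using Fs pos by (intro mult_left_mono divide_right_mono) auto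
  \<comment> \<open>Since \<open>F = s * exp (- L)\<close>, the growth
    \<open>exp (2 * L / 3)\<close> is outweighed. The remaining decay \<open>exp (- (L / 3))\<close>
    supplies the factor 1 / L needed for the indicator term.\<close>
  also have "\<dots> = 2 * r\<^sup>2 * exp (- (L / 3))"
  proof -
    have "F = s * exp (- L)" by (simp add: sF exp_minus)
    then have "exp (2 * L / 3) * (2 * (s * F) / d\<^sup>2) = 2 * r\<^sup>2 * (exp (2 * L / 3) * exp (- L))"
      by (simp add: r_def power2_eq_square)
    also have "exp (2 * L / 3) * exp (- L) = exp (- (L / 3))" by (simp add: exp_add[symmetric])
    finally show ?thesis .
  qed
  finally have B: "B \<le> 2 * r\<^sup>2 * exp (- (L / 3))" .
  have e1: "exp (- (L / 3)) \<le> 1" using L1 by simp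
  have e2: "exp (- (L / 3)) \<le> 3 / L"
  proof -
    have "L / 3 \<le> exp (L / 3)" using exp_ge_add_one_self[of "L / 3"] by linarith
    then show ?thesis using L1 by (simp add: exp_minus field_simps)
  qed
  have B1: "B \<le> 2 * r\<^sup>2"
    using B mult_left_mono[OF e1, of "2 * r\<^sup>2"] by simp
  have B2: "B \<le> 6 * r / L"
  proof -
    have "2 * r\<^sup>2 * exp (- (L / 3)) \<le> 2 * r * (3 / L)"
      using r e2 L1 by (intro mult_mono) (auto simp: power2_eq_square mult_left_le)
    then show ?thesis using B by simp
  qed
  show ?thesis
  proof (rule that[of a b])
    show "0 \<le> a" "0 \<le> b" using r L1 by (auto simp: a_def b_def)
    fix U :: real
    have "(\<bar>U\<bar> - r)\<^sup>2 \<ge> 0" by simp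
    then have "\<bar>U\<bar> \<le> (U\<^sup>2 / r + r) / 2" using r by (simp add: power2_eq_square field_simps)
    then have "960 / L * (2 * r + \<bar>U\<bar>) \<le> 960 / L * (2 * r + (U\<^sup>2 / r + r) / 2)"
      using L1 by (intro mult_left_mono) auto
    also have "\<dots> = a + 480 / (r * L) * U\<^sup>2" using r L1 by (simp add: a_def field_simps)
    finally have 1: "960 / L * (2 * r + \<bar>U\<bar>) \<le> a + 480 / (r * L) * U\<^sup>2" .
    have 2: "(if \<bar>U\<bar> > 1/4 then 321 else 0) \<le> 5136 * U\<^sup>2"
    proof (cases "\<bar>U\<bar> > 1/4")
      case True
      then have "(1/4)\<^sup>2 \<le> \<bar>U\<bar>\<^sup>2" by (intro power_mono) auto
      then show ?thesis using True by (simp add: power2_eq_square)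
    qed auto
    show "960 / L * (2 * (s / d) + \<bar>U\<bar>) + (if \<bar>U\<bar> > 1/4 then 321 else 0) \<le> a + b * U\<^sup>2"
      using 1 2 unfolding r_def[symmetric] b_def distrib_right by linarith
  next
    have "480 / (r * L) * B \<le> 480 / (r * L) * (2 * r\<^sup>2)"
      using B1 r L1 by (intro mult_left_mono) auto
    also have "\<dots> = 960 * (r / L)" using r L1 by (simp add: power2_eq_square field_simps)
    finally have "b * B \<le> 960 * (r / L) + 5136 * (6 * r / L)"
      unfolding b_def distrib_right using B2 by (intro add_mono mult_left_mono) auto
    moreover have "0 \<le> r / L" using r L1 by simp
    ultimately have "a + b * B \<le> 40000 * (r / L)" unfolding a_def times_divide_eq_right[symmetric] by linarith
    moreover have "r / L = s / (d * L)" by (simp add: r_def)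
    moreover have "0 \<le> F / d" using pos by simp
    ultimately show "a + b * (exp (2 * L / 3) * ((F\<^sup>2 + s * F) / d\<^sup>2)) \<le> 40000 * (s / (d * L) + F / d)"
      unfolding B_def by simp
  qed
next
  case False
  then have L1: "L = 1" using L by auto
  have "s / F < exp 1" using False pos by (subst (asm) not_le) (metis exp_less_mono exp_ln divide_pos_pos)
  then have "s / F < 3" using exp_le by linarith
  then have s3: "s \<le> 3 * F" using pos by (simp add: field_simps)
  define q where "q = F / d"
  have q: "0 < q" using pos by (simp add: q_def)
  define B where "B = exp (2 * L / 3) * ((F\<^sup>2 + s * F) / d\<^sup>2)"
  have "exp (2 * L / 3) \<le> exp (1 :: real)" by (simp add: L1)
  then have e3: "exp (2 * L / 3) \<le> (3 :: real)" using exp_le by linarith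
  have "s * F \<le> 3 * F * F" using s3 pos by (intro mult_right_mono) auto
  then have "(F\<^sup>2 + s * F) / d\<^sup>2 \<le> 4 * F\<^sup>2 / d\<^sup>2" using pos by (intro divide_right_mono) (auto simp: power2_eq_square)
  then have "B \<le> 3 * (4 * F\<^sup>2 / d\<^sup>2)" unfolding B_def using e3 pos by (intro mult_mono) auto
  then have B: "B \<le> 12 * q\<^sup>2" by (simp add: q_def power_divide)
  \<comment> \<open>Here \<open>s\<close> is at most \<open>3 * F\<close>, so \<open>F / d\<close>
    serves as the AM-GM weight. The coefficient 1122 is half of 960 + 4 * 321, as the indicator is
    bounded by 4 times the modulus of the noise.\<close>
  define a where "a = 1920 * (s / d) + 1122 * q"
  define b where "b = 1122 / q"
  show ?thesis
  proof (rule that[of a b])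
    show "0 \<le> a" "0 \<le> b" using q pos by (auto simp: a_def b_def)
    fix U :: real
    have "(\<bar>U\<bar> - q)\<^sup>2 \<ge> 0" by simp
    then have "\<bar>U\<bar> \<le> (U\<^sup>2 / q + q) / 2" using q by (simp add: power2_eq_square field_simps)
    then have "2244 * \<bar>U\<bar> \<le> 1122 * q + b * U\<^sup>2" by (simp add: b_def)
    moreover have "(if \<bar>U\<bar> > 1/4 then 321 else 0) \<le> 1284 * \<bar>U\<bar>" by auto
    ultimately show "960 / L * (2 * (s / d) + \<bar>U\<bar>) + (if \<bar>U\<bar> > 1/4 then 321 else 0) \<le> a + b * U\<^sup>2"
      unfolding L1 a_def by simp
  next
    have "b * B \<le> b * (12 * q\<^sup>2)" using B q by (intro mult_left_mono) (auto simp: b_def)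
    also have "\<dots> = 13464 * q" using q by (simp add: b_def power2_eq_square)
    finally have "a + b * B \<le> 1920 * (s / d) + 14586 * q" by (simp add: a_def)
    moreover have "0 \<le> s / d" using pos by simp
    ultimately show "a + b * (exp (2 * L / 3) * ((F\<^sup>2 + s * F) / d\<^sup>2)) \<le> 40000 * (s / (d * L) + F / d)"
      unfolding B_def L1 using q by (simp add: q_def)
  qed
qed

text \<open>
  For \<open>k < 7\<close> these are the values \<open>t / v\<close> with \<open>t\<close> a power of two that \<open>t_hat\<close> can attain on the
  good event. The remaining level \<open>1/4\<close> serves to bound \<open>t_hat\<close> from below.
\<close>

definition scale_grid :: "real \<Rightarrow> nat \<Rightarrow> real" where
  "scale_grid v k = (if k < 7 then 2 powr (real_of_int \<lceil>log 2 (v / 4)\<rceil> + real k) / v else 1/4)"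

lemma scale_grid_bounds:
  assumes v: "0 < v"
  shows "1/4 \<le> scale_grid v k" "scale_grid v k \<le> 40"
proof -
  define m where "m = \<lceil>log 2 (v / 4)\<rceil>"
  have "log 2 (v / 4) \<le> m" "m < log 2 (v / 4) + 1" unfolding m_def by linarith+
  then have "2 powr log 2 (v / 4) \<le> 2 powr m" "2 powr m \<le> 2 powr (log 2 (v / 4) + 1)"
    by (auto intro!: powr_mono)
  then have m: "v / 4 \<le> 2 powr m" "2 powr m \<le> 2 * (v / 4)"
    using v by (simp_all add: powr_add)
  have "1/4 \<le> scale_grid v k \<and> scale_grid v k \<le> 40"
  proof (cases "k < 7")
    case True
    have p: "1 \<le> (2::real) ^ k" "(2::real) ^ k \<le> 2 ^ 6"
      using True power_increasing[of k 6 "2::real"] by simp_all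
    have eq: "scale_grid v k = 2 powr m / v * 2 ^ k"
      using True by (simp add: scale_grid_def m_def powr_add powr_realpow)
    have "1/4 * 1 \<le> 2 powr m / v * 2 ^ k" using m v p by (intro mult_mono) (auto simp: field_simps)
    moreover have "2 powr m / v * 2 ^ k \<le> 1/2 * 2 ^ 6" using m v p by (intro mult_mono) (auto simp: field_simps)
    ultimately show ?thesis unfolding eq by simp
  qed (simp add: scale_grid_def)
  then show "1/4 \<le> scale_grid v k" "scale_grid v k \<le> 40" by auto
qed

text \<open>The exponent is at least the ceiling of \<open>log 2 (v / 4)\<close>; raising that
  ceiling by 7 would give at least \<open>32 * v\<close>, beyond the allowed
  \<open>10 * v\<close>.\<close>

lemma scale_grid_covers:
  fixes l :: int
  assumes v: "0 < v" and l: "v / 4 < 2 powr real_of_int l" "2 powr real_of_int l \<le> 10 * v"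
  obtains k where "k < 7" "2 powr real_of_int l = scale_grid v k * v"
proof -
  define m where "m = \<lceil>log 2 (v / 4)\<rceil>"
  have "log 2 (v / 4) < l" using l(1) v by (simp add: log_less_iff)
  then have ml: "m \<le> l" unfolding m_def by linarith
  have "log 2 (v / 4) \<le> m" unfolding m_def by linarith
  then have m: "v / 4 \<le> 2 powr m" using v by (simp add: log_le_iff)
  have "l < m + 7"
  proof (rule ccontr)
    assume "\<not> l < m + 7"
    then have "2 powr real_of_int (m + 7) \<le> 2 powr real_of_int l" by (intro powr_mono) auto
    moreover have "2 powr real_of_int (m + 7) = 2 powr m * 128" by (simp add: powr_add)
    ultimately have "128 * (v / 4) \<le> 10 * v" using l(2) m by linarith
    then show False using v by simp
  qed
  then show ?thesis
    using ml v by (intro that[of "nat (l - m)"]) (auto simp: scale_grid_def m_def[symmetric])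
qed

text \<open>The frequency used by the estimator is random through \<open>t_hat\<close>; summing over
  the fixed grid replaces it by finitely many deterministic frequencies. The first sum covers the
  good event. On the bad event some deviation exceeds its threshold, so the last product dominates
  the crude bound \<open>1 + 40 * Q\<close>.\<close>

lemma pointwise_error_bound:
  fixes d s n :: nat and \<sigma> \<delta> w \<eta> :: real and \<tau> x \<gamma> :: "nat \<Rightarrow> real"
    and \<Sigma> :: "nat \<Rightarrow> nat \<Rightarrow> real"
  defines "v \<equiv> \<sigma>\<^sup>2" and "N \<equiv> {i\<in>{..<d}. \<tau> i = 0}" and "L \<equiv> 6 * lam d s \<Sigma>"
  defines "u \<equiv> \<lambda>k. sqrt (lam d s \<Sigma> / (scale_grid v k * v))"
  defines "c \<equiv> \<lambda>k j. real j * w / sqrt (scale_grid v k)"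
  defines "e \<equiv> \<lambda>k. exp (- (u k * \<sigma>)\<^sup>2 / 2)"
  defines "U \<equiv> \<lambda>k. (\<Sum>i<d. cos (u k * \<tau> i + u k * \<sigma> * x i) - cos (u k * \<tau> i) * e k) / real d / e k"
  defines "V \<equiv> \<lambda>k j. (\<Sum>i\<in>N. cos (c k j * x i) - exp (- (c k j)\<^sup>2 / 2)) / real d"
  defines "V0 \<equiv> (\<Sum>i\<in>N. (x i)\<^sup>2 - 1) / real d"
  defines "Q \<equiv> (\<Sum>i\<in>N. (x i)\<^sup>2) / real d"
  assumes d: "1 \<le> d" and \<sigma>: "0 < \<sigma>" and \<delta>: "0 < \<delta>" "\<delta> \<le> 1/100"
    and s: "real s \<le> \<delta> * real d" and card: "card {i\<in>{..<d}. \<tau> i \<noteq> 0} \<le> s"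
    and y: "\<And>i. i < d \<Longrightarrow> Ytil \<Sigma> Y i = \<tau> i + \<sigma> * x i"
    and nz: "\<And>i. i \<in> N \<Longrightarrow> x i \<noteq> 0"
    and maj: "\<And>\<xi> z. 1/4 \<le> \<xi> \<Longrightarrow> \<xi> \<le> 40 \<Longrightarrow>
       (if z\<^sup>2 \<le> \<xi> then 1 else 0) \<le> (\<Sum>j\<le>n. \<gamma> j * cos (real j * w / sqrt \<xi> * z))"
    and mean: "\<And>\<xi>. 1/4 \<le> \<xi> \<Longrightarrow> \<xi> \<le> 40 \<Longrightarrow>
       (\<Sum>j\<le>n. \<gamma> j * exp (- (real j * w / sqrt \<xi>)\<^sup>2 / 2)) \<le> chi2_1_cdf \<xi> + \<delta>"
    and gap: "\<And>\<xi>. 1/4 \<le> \<xi> \<Longrightarrow> \<xi> \<le> 40 \<Longrightarrow> chi2_1_cdf \<xi> + 3 * \<delta> \<le> chi2_1_cdf (2 * \<xi>)"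
    and \<eta>: "0 < \<eta>" "\<eta> \<le> 1" "\<eta> * (\<Sum>j\<le>n. \<bar>\<gamma> j\<bar>) \<le> \<delta>"
  shows "real_of_ereal \<bar>sigmaD_hat_sq d s \<Sigma> Y - ereal v\<bar> / v
    \<le> (\<Sum>k<7. 960 / L * (2 * (real s / real d) + \<bar>U k\<bar>) + (if \<bar>U k\<bar> > 1/4 then 321 else 0))
      + (\<bar>V0\<bar> + (\<Sum>k\<le>7. \<Sum>j\<le>n. \<bar>V k j\<bar>)) / \<eta> * (1 + 40 * Q)"
    (is "?err / v \<le> (\<Sum>k<7. ?T k) + ?B / \<eta> * _")
proof -
  define t where "t = t_hat d \<Sigma> Y"
  have v: "0 < v" using \<sigma> by (simp add: v_def)
  have d0: "0 < real d" using d by simp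
  have NS: "{..<d} - N = {i\<in>{..<d}. \<tau> i \<noteq> 0}" by (auto simp: N_def)
  have Nd: "N \<subseteq> {..<d}" by (auto simp: N_def)
  have out: "real (card ({..<d} - N)) \<le> real s" unfolding NS using card by simp
  have out\<delta>: "real (card ({..<d} - N)) \<le> \<delta> * real d" using out s by linarith
  have "\<delta> * real d \<le> 1/100 * real d" using \<delta> by (intro mult_right_mono) auto
  then have s100: "real s \<le> real d / 100" using s by linarith
  have yN: "Ytil \<Sigma> Y i = \<sigma> * x i" if "i \<in> N" for i using y that by (auto simp: N_def)
  have "{i\<in>{..<d}. Ytil \<Sigma> Y i = 0} \<subseteq> {..<d} - N"
    using yN nz \<sigma> by auto
  then have "card {i\<in>{..<d}. Ytil \<Sigma> Y i = 0} \<le> card ({..<d} - N)" by (intro card_mono) auto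
  then have "2 * real (card {i\<in>{..<d}. Ytil \<Sigma> Y i = 0}) < real d" using out s100 d0 by linarith
  then have "2 * card {i\<in>{..<d}. Ytil \<Sigma> Y i = 0} < d" by linarith
  then obtain l :: int where l: "t = 2 powr real_of_int l" "1/2 \<le> emp_cdf d \<Sigma> Y t" "emp_cdf d \<Sigma> Y (t / 2) < 1/2"
    using t_hat_properties[OF d, of \<Sigma> Y] unfolding t_def by metis
  have t0: "0 < t" by (simp add: l(1))
  have "t / 2 \<le> 5/2 * \<sigma>\<^sup>2 * Q"
    unfolding Q_def using d t0 l(3) Nd out s100 yN d0 by (intro emp_cdf_less_half_imp_le) auto
  then have tQ: "t \<le> 5 * v * Q" by (simp add: v_def)
  have lam0: "0 < lam d s \<Sigma>" by (rule lam_pos)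
  have L0: "0 < L" using lam0 by (simp add: L_def)
  have Q0: "0 \<le> Q" unfolding Q_def by (intro divide_nonneg_nonneg sum_nonneg) auto
  have crude: "?err \<le> v + 8 * t" unfolding t_def using l(2) v by (intro sigmaD_error_crude) (simp_all add: t_def)
  have T0: "0 \<le> ?T k" for k using L0 d0 by simp
  have B0: "0 \<le> ?B" by (intro add_nonneg_nonneg sum_nonneg) auto
  show ?thesis
  proof (cases "1 < \<bar>V0\<bar> \<or> (\<exists>k\<le>7. \<exists>j\<le>n. \<eta> < \<bar>V k j\<bar>)")
    case True
    have "\<eta> \<le> ?B"
    proof (cases "1 < \<bar>V0\<bar>")
      case True
      have "0 \<le> (\<Sum>k\<le>7. \<Sum>j\<le>n. \<bar>V k j\<bar>)" by (intro sum_nonneg) auto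
      then show ?thesis using True \<eta> by linarith
    next
      case False
      then obtain k j where kj: "k \<le> 7" "j \<le> n" "\<eta> < \<bar>V k j\<bar>" using True by blast
      have "\<bar>V k j\<bar> \<le> (\<Sum>j\<le>n. \<bar>V k j\<bar>)" using kj by (intro member_le_sum) auto
      also have "\<dots> \<le> (\<Sum>k\<le>7. \<Sum>j\<le>n. \<bar>V k j\<bar>)"
        using kj by (intro member_le_sum[where f="\<lambda>k. \<Sum>j\<le>n. \<bar>V k j\<bar>"]) (auto intro: sum_nonneg)
      finally show ?thesis using kj by linarith
    qed
    then have B1: "1 \<le> ?B / \<eta>" using \<eta> by simp
    have "?err / v \<le> (v + 8 * t) / v" using crude v by (intro divide_right_mono) auto
    also have "\<dots> \<le> (v + 8 * (5 * v * Q)) / v" using tQ v by (intro divide_right_mono add_left_mono mult_left_mono) auto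
    also have "\<dots> = 1 * (1 + 40 * Q)" using v by (simp add: field_simps)
    also have "\<dots> \<le> ?B / \<eta> * (1 + 40 * Q)" using B1 Q0 by (intro mult_right_mono) auto
    finally show ?thesis using sum_nonneg[of "{..<7}" ?T, OF T0] by linarith
  next
    case False
    then have V0: "\<bar>V0\<bar> \<le> 1" and V: "\<And>k j. k \<le> 7 \<Longrightarrow> j \<le> n \<Longrightarrow> \<bar>V k j\<bar> \<le> \<eta>" by (auto simp: not_less)
    have cdf: "emp_cdf d \<Sigma> Y (scale_grid v k * v) \<le> chi2_1_cdf (scale_grid v k) + 3 * \<delta>" if "k \<le> 7" for k
      unfolding v_def
      by (rule emp_cdf_le_of_trig_averages[OF d \<sigma> Nd out\<delta> yN, where c="c k" and \<gamma>=\<gamma> and n=n and \<eta>=\<eta>])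
        (use maj mean V[OF that] \<eta>(3) scale_grid_bounds[OF v] in \<open>auto simp: c_def V_def v_def\<close>)
    \<comment> \<open>This is the extra grid level: 9/20 + 3 * \<delta> stays below 1/2, so
      \<open>t\<close> cannot be as small as \<open>v / 4\<close>.\<close>
    have "emp_cdf d \<Sigma> Y (v / 4) \<le> chi2_1_cdf (1/4) + 3 * \<delta>"
      using cdf[of 7] by (simp add: scale_grid_def)
    then have "emp_cdf d \<Sigma> Y (v / 4) < 1/2" using chi2_1_cdf_quarter_le \<delta> by linarith
    then have tv: "v / 4 < t" using emp_cdf_mono[of t "v / 4" d \<Sigma> Y] l(2) by (cases "t \<le> v / 4") auto
    have "Q = V0 + real (card N) / real d"
      by (simp add: Q_def V0_def sum_subtractf diff_divide_distrib)
    moreover have "real (card N) \<le> real d" using card_mono[OF _ Nd] by simp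
    then have "real (card N) / real d \<le> 1" using d0 by simp
    ultimately have "Q \<le> 2" using V0 by linarith
    then have "5 * v * Q \<le> 5 * v * 2" using v by (intro mult_left_mono) auto
    then have "t \<le> 10 * v" using tQ by linarith
    then obtain k where k: "k < 7" "t = scale_grid v k * v"
      using scale_grid_covers[OF v, of l] tv l(1) by metis
    define \<xi> where "\<xi> = scale_grid v k"
    have \<xi>: "1/4 \<le> \<xi>" "\<xi> \<le> 40" "t / v = \<xi>" "t = \<xi> * v"
      using scale_grid_bounds[OF v] k v by (auto simp: \<xi>_def)
    have uk: "u k = sqrt (lam d s \<Sigma> / t)" by (simp add: u_def k)
    have "(u k * \<sigma>)\<^sup>2 = lam d s \<Sigma> * v / t" unfolding uk using lam0 t0 by (simp add: power_mult_distrib v_def)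
    then have ek: "e k = exp (- (lam d s \<Sigma> * v / t) / 2)" by (simp add: e_def)
    have e0: "0 < e k" by (simp add: e_def)
    have "real (card {i\<in>{..<d}. \<tau> i \<noteq> 0}) \<le> (real s / real d) * real d" using card d by simp
    then obtain r where r: "\<bar>r\<bar> \<le> 2 * (real s / real d)"
      "(\<Sum>i<d. cos (u k * \<tau> i + u k * \<sigma> * x i)) / real d = e k * (1 + (r + U k))"
      unfolding U_def using phi_hat_decomposition[OF d e0, of \<tau> "real s / real d" "u k" "\<lambda>i. u k * \<sigma> * x i"] by blast
    have phi: "phi_hat d \<Sigma> Y (u k) = (\<Sum>i<d. cos (u k * \<tau> i + u k * \<sigma> * x i)) / real d"
      unfolding phi_hat_def using y by (simp add: distrib_left mult.assoc)
    have err_le: "?err / v \<le> ?T k"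
    \<comment> \<open>The bias is at most 2/100, so a total above 1/2 forces the noise above 1/4;
      the crude error is then at most 1 + 8 * 40 = 321. Otherwise the linearised error has factor
      \<open>24 * \<xi> / L\<close>, at most \<open>960 / L\<close>.\<close>
    proof (cases "\<bar>r + U k\<bar> \<le> 1/2")
      case True
      have "emp_cdf d \<Sigma> Y t \<le> chi2_1_cdf (2 * (t / v))"
        using cdf[of k] gap[of \<xi>] \<xi> k by (simp add: \<xi>_def)
      then have "?err \<le> 4 * t / lam d s \<Sigma> * \<bar>r + U k\<bar>"
        using l(2) v phi r(2) True unfolding t_def
        by (intro sigmaD_error_fine) (auto simp: uk ek t_def simp del: ereal_minus)
      then have "?err / v \<le> 4 * t / lam d s \<Sigma> * \<bar>r + U k\<bar> / v" using v by (intro divide_right_mono) auto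
      also have "\<dots> = 24 * \<xi> / L * \<bar>r + U k\<bar>" using v by (simp add: \<xi>(4) L_def)
      also have "\<dots> \<le> 960 / L * (2 * (real s / real d) + \<bar>U k\<bar>)"
        using \<xi> L0 r(1) by (intro mult_mono divide_right_mono) auto
      finally show ?thesis by (simp split: if_splits)
    next
      case False
      have "real s / real d \<le> 1/100" using s100 d0 by (simp add: field_simps)
      then have "\<bar>U k\<bar> > 1/4" using False r(1) by linarith
      moreover have "?err / v \<le> (v + 8 * t) / v" using crude v by (intro divide_right_mono) auto
      moreover have "(v + 8 * t) / v = 1 + 8 * \<xi>" using v by (simp add: \<xi>(4) field_simps)
      moreover have "0 \<le> 960 / L * (2 * (real s / real d) + \<bar>U k\<bar>)" using L0 d0 by simp
      ultimately show ?thesis using \<xi>(2) by simp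
    qed
    also have "\<dots> \<le> (\<Sum>k<7. ?T k)" using k T0 by (intro member_le_sum[where f="?T"]) auto
    finally show ?thesis using B0 \<eta> Q0 by (simp add: add_increasing2)
  qed
qed

section \<open>Risk bound\<close>

context std_gaussian_family
begin

text \<open>The normal law has no atoms. Almost surely only outliers can then be observed as exact
  zeros, which is what keeps \<open>t_hat\<close> well defined.\<close>

lemma AE_X_nonzero: "AE x in M. \<forall>i<d. X i x \<noteq> 0"
proof -
  have "AE x in M. X i x \<noteq> 0" if i: "i < d" for i
  proof -
    have "AE z in std_normal_distribution. z \<noteq> 0"
      using AE_lborel_singleton[of 0] by (subst AE_density) auto
    then have "AE z in distr M borel (X i). z \<noteq> 0" by (simp only: distr_X[OF i])
    then show ?thesis using i by (subst (asm) AE_distr_iff) auto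
  qed
  then have "\<forall>i\<in>{..<d}. AE x in M. X i x \<noteq> 0" by simp
  then have "AE x in M. \<forall>i\<in>{..<d}. X i x \<noteq> 0" by (intro AE_finite_allI) auto
  then show ?thesis by (simp only: lessThan_iff Ball_def)
qed

text \<open>The pointwise bound is dominated by an integrable function quadratic in the deviations,
  whose expectation needs only the second moments computed above.\<close>

lemma risk_bound:
  fixes s n :: nat and \<sigma> \<delta> w \<eta> :: real and \<tau> \<gamma> :: "nat \<Rightarrow> real"
    and \<Sigma> :: "nat \<Rightarrow> nat \<Rightarrow> real" and Y :: "'a \<Rightarrow> nat \<Rightarrow> real"
  assumes d: "1 \<le> d" and s1: "1 \<le> s" and \<sigma>: "0 < \<sigma>" and \<delta>: "0 < \<delta>" "\<delta> \<le> 1/100"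
    and s: "real s \<le> \<delta> * real d" and card: "card {i\<in>{..<d}. \<tau> i \<noteq> 0} \<le> s"
    and y: "\<And>x i. i < d \<Longrightarrow> Ytil \<Sigma> (Y x) i = \<tau> i + \<sigma> * X i x"
    and frob: "frob_til d \<Sigma> = frob" "0 < frob"
    and maj: "\<And>\<xi> z. 1/4 \<le> \<xi> \<Longrightarrow> \<xi> \<le> 40 \<Longrightarrow>
       (if z\<^sup>2 \<le> \<xi> then 1 else 0) \<le> (\<Sum>j\<le>n. \<gamma> j * cos (real j * w / sqrt \<xi> * z))"
    and mean: "\<And>\<xi>. 1/4 \<le> \<xi> \<Longrightarrow> \<xi> \<le> 40 \<Longrightarrow>
       (\<Sum>j\<le>n. \<gamma> j * exp (- (real j * w / sqrt \<xi>)\<^sup>2 / 2)) \<le> chi2_1_cdf \<xi> + \<delta>"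
    and gap: "\<And>\<xi>. 1/4 \<le> \<xi> \<Longrightarrow> \<xi> \<le> 40 \<Longrightarrow> chi2_1_cdf \<xi> + 3 * \<delta> \<le> chi2_1_cdf (2 * \<xi>)"
    and \<eta>: "0 < \<eta>" "\<eta> \<le> 1" "\<eta> * (\<Sum>j\<le>n. \<bar>\<gamma> j\<bar>) \<le> \<delta>"
  shows "(\<integral>\<^sup>+ x. ennreal (real_of_ereal \<bar>sigmaD_hat_sq d s \<Sigma> (Y x) - ereal (\<sigma>\<^sup>2)\<bar> / \<sigma>\<^sup>2) \<partial>M)
    \<le> ennreal ((280000 + real (8 * n + 9) * 4802 / \<eta>) *
        (real s / (real d * max 1 (ln (real s / frob_til d \<Sigma>))) + frob_til d \<Sigma> / real d))"
proof -
  define v where "v = \<sigma>\<^sup>2"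
  define N where "N = {i\<in>{..<d}. \<tau> i = 0}"
  define \<mu> where "\<mu> = lam d s \<Sigma>"
  define L where "L = 6 * \<mu>"
  define u where "u k = sqrt (\<mu> / (scale_grid v k * v))" for k
  define c where "c k j = real j * w / sqrt (scale_grid v k)" for k j :: nat
  define e where "e k = exp (- (u k * \<sigma>)\<^sup>2 / 2)" for k
  define U where "U k x = (\<Sum>i<d. centred_cos (u k * \<sigma>) (u k * \<tau> i) i x) / real d / e k" for k x
  define V where "V k j x = (\<Sum>i\<in>N. centred_cos (c k j) 0 i x) / real d" for k j x
  define V0 where "V0 x = (\<Sum>i\<in>N. (X i x)\<^sup>2 - 1) / real d" for x
  define Q where "Q x = (\<Sum>i\<in>N. (X i x)\<^sup>2) / real d" for x
  define F where "F = frob"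
  have Nd: "N \<subseteq> {..<d}" by (auto simp: N_def)
  have F: "0 < F" using frob by (simp add: F_def)
  have v: "0 < v" using \<sigma> by (simp add: v_def)
  have d0: "0 < real d" using d by simp
  have L: "L = max 1 (ln (real s / F))" by (simp add: L_def \<mu>_def lam_def F_def frob)
  have sd: "real s \<le> real d"
  proof -
    have "\<delta> * real d \<le> 1 * real d" using \<delta> by (intro mult_right_mono) auto
    then show ?thesis using s by simp
  qed
  obtain a b where ab: "0 \<le> a" "0 \<le> b"
    "\<And>U. 960 / L * (2 * (real s / real d) + \<bar>U\<bar>) + (if \<bar>U\<bar> > 1/4 then 321 else 0) \<le> a + b * U\<^sup>2"
    "a + b * (exp (2 * L / 3) * ((F\<^sup>2 + real s * F) / (real d)\<^sup>2)) \<le> 40000 * (real s / (real d * L) + F / real d)"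
    using quadratic_majorant[of "real s" "real d" F L] s1 d0 sd F L by auto
  \<comment> \<open>AM-GM weight for the products on the bad event: both \<kappa> times a
    deviation's second moment and the mean of \<open>P\<close> become of order
    \<open>F / d\<close>.\<close>
  define \<kappa> where "\<kappa> = real d / F"
  have \<kappa>: "0 < \<kappa>" "1 / \<kappa> = F / real d" "\<kappa> * (F\<^sup>2 / (real d)\<^sup>2) = F / real d"
    using d0 F by (auto simp: \<kappa>_def power2_eq_square)
  define P where "P x = (1 + 40 * Q x)\<^sup>2 / \<kappa>" for x
  define H where "H x = (\<Sum>k<7::nat. a + b * (U k x)\<^sup>2)
      + ((\<kappa> * (V0 x)\<^sup>2 + P x) + (\<Sum>k\<le>7::nat. \<Sum>j\<le>n. \<kappa> * (V k j x)\<^sup>2 + P x)) / (2 * \<eta>)" for x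

  have amgm: "\<bar>p\<bar> * q \<le> (\<kappa> * p\<^sup>2 + q\<^sup>2 / \<kappa>) / 2" for p q :: real
  proof -
    have "0 \<le> (\<kappa> * \<bar>p\<bar> - q)\<^sup>2 / \<kappa>" using \<kappa> by simp
    then show ?thesis using \<kappa>(1) by (simp add: power2_eq_square field_simps)
  qed
  have pointwise: "real_of_ereal \<bar>sigmaD_hat_sq d s \<Sigma> (Y x) - ereal v\<bar> / v \<le> H x"
    if nz: "\<forall>i<d. X i x \<noteq> 0" for x
  proof -
    have "real_of_ereal \<bar>sigmaD_hat_sq d s \<Sigma> (Y x) - ereal v\<bar> / v
      \<le> (\<Sum>k<7. 960 / L * (2 * (real s / real d) + \<bar>U k x\<bar>) + (if \<bar>U k x\<bar> > 1/4 then 321 else 0))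
      + (\<bar>V0 x\<bar> + (\<Sum>k\<le>7. \<Sum>j\<le>n. \<bar>V k j x\<bar>)) / \<eta> * (1 + 40 * Q x)"
      using pointwise_error_bound[where \<tau>=\<tau> and x="\<lambda>i. X i x" and Y="Y x" and \<Sigma>=\<Sigma> and \<gamma>=\<gamma> and w=w and n=n,
          OF d \<sigma> \<delta> s card y _ maj mean gap \<eta>] nz
      by (simp add: U_def V_def V0_def Q_def L_def \<mu>_def u_def c_def e_def N_def v_def centred_cos_def)
    also have "\<dots> \<le> (\<Sum>k<7::nat. a + b * (U k x)\<^sup>2)
      + (\<bar>V0 x\<bar> * (1 + 40 * Q x) + (\<Sum>k\<le>7. \<Sum>j\<le>n. \<bar>V k j x\<bar> * (1 + 40 * Q x))) / \<eta>"
      by (intro add_mono sum_mono ab(3)) (simp add: sum_distrib_right distrib_right)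
    also have "\<dots> \<le> (\<Sum>k<7::nat. a + b * (U k x)\<^sup>2)
      + ((\<kappa> * (V0 x)\<^sup>2 + P x) / 2 + (\<Sum>k\<le>7::nat. \<Sum>j\<le>n. (\<kappa> * (V k j x)\<^sup>2 + P x) / 2)) / \<eta>"
      unfolding P_def using \<eta>(1)
      by (intro add_mono sum_mono amgm divide_right_mono order_refl) auto
    also have "\<dots> = H x"
      unfolding H_def by (simp add: sum_divide_distrib add_divide_distrib mult.commute)
    finally show ?thesis .
  qed

  have U2: "integrable M (\<lambda>x. (U k x)\<^sup>2)"
    "expectation (\<lambda>x. (U k x)\<^sup>2) \<le> exp (2 * L / 3) * ((F\<^sup>2 + real s * F) / (real d)\<^sup>2)" for k
  proof -
    have sub: "{..<d} \<subseteq> {..<d}" by simp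
    note m = second_moment_centred_cos[OF sub, of "u k * \<sigma>" "\<lambda>i. u k * \<tau> i"]
    define Z where "Z x = (\<Sum>i<d. centred_cos (u k * \<sigma>) (u k * \<tau> i) i x)\<^sup>2" for x
    have eq: "(U k x)\<^sup>2 = Z x * (1 / ((real d)\<^sup>2 * (e k)\<^sup>2))" for x
      by (simp add: U_def Z_def power_divide power_mult_distrib)
    show "integrable M (\<lambda>x. (U k x)\<^sup>2)" unfolding eq using m(1) by (simp add: Z_def)
    have "card {i\<in>{..<d}. u k * \<tau> i \<noteq> 0} \<le> card {i\<in>{..<d}. \<tau> i \<noteq> 0}" by (intro card_mono) auto
    then have "real (card {i\<in>{..<d}. u k * \<tau> i \<noteq> 0}) * F \<le> real s * F"
      using card F by (intro mult_right_mono) auto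
    then have Z: "expectation Z \<le> F\<^sup>2 + real s * F" using m(2) unfolding Z_def F_def by linarith
    have grid: "1/4 \<le> scale_grid v k" by (rule scale_grid_bounds[OF v])
    have \<mu>0: "0 < \<mu>" by (simp add: \<mu>_def lam_pos)
    have "(u k * \<sigma>)\<^sup>2 = \<mu> / scale_grid v k"
      using \<mu>0 grid v by (simp add: u_def power_mult_distrib v_def[symmetric])
    \<comment> \<open>The lower bound on the grid limits the amplification of the noise: 4 * \<mu>
      equals 2 * L / 3.\<close>
    also have "\<dots> \<le> \<mu> / (1/4)" using grid \<mu>0 by (intro divide_left_mono) auto
    finally have "(u k * \<sigma>)\<^sup>2 \<le> 2 * L / 3" by (simp add: L_def)
    moreover have "1 / (e k)\<^sup>2 = exp ((u k * \<sigma>)\<^sup>2)"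
      by (simp add: e_def exp_minus power2_eq_square exp_add[symmetric] field_simps)
    ultimately have e2: "1 / (e k)\<^sup>2 \<le> exp (2 * L / 3)" by simp
    have "expectation (\<lambda>x. (U k x)\<^sup>2) = expectation Z * (1 / ((real d)\<^sup>2 * (e k)\<^sup>2))"
      unfolding eq by simp
    also have "\<dots> = expectation Z / (real d)\<^sup>2 * (1 / (e k)\<^sup>2)" by simp
    also have "\<dots> \<le> (F\<^sup>2 + real s * F) / (real d)\<^sup>2 * exp (2 * L / 3)"
      using Z e2 F by (intro mult_mono divide_right_mono divide_nonneg_nonneg) auto
    finally show "expectation (\<lambda>x. (U k x)\<^sup>2) \<le> exp (2 * L / 3) * ((F\<^sup>2 + real s * F) / (real d)\<^sup>2)"
      by (simp add: mult.commute)
  qed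
  \<comment> \<open>The factor 2 is slack for the cosines; it matches the bound for the squares, so
    that \<open>step\<close> serves both.\<close>
  have V2: "integrable M (\<lambda>x. (V k j x)\<^sup>2)" "expectation (\<lambda>x. (V k j x)\<^sup>2) \<le> 2 * (F\<^sup>2 / (real d)\<^sup>2)" for k j
  proof -
    note m = second_moment_centred_cos[OF Nd, of "c k j" "\<lambda>_. 0"]
    have eq: "(V k j x)\<^sup>2 = (\<Sum>i\<in>N. centred_cos (c k j) 0 i x)\<^sup>2 / (real d)\<^sup>2" for x
      by (simp add: V_def power_divide)
    show "integrable M (\<lambda>x. (V k j x)\<^sup>2)" unfolding eq using m(1) by simp
    have "expectation (\<lambda>x. (V k j x)\<^sup>2) \<le> F\<^sup>2 / (real d)\<^sup>2"
      unfolding eq using m(2) by (simp add: divide_right_mono F_def)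
    moreover have "0 \<le> F\<^sup>2 / (real d)\<^sup>2" by simp
    ultimately show "expectation (\<lambda>x. (V k j x)\<^sup>2) \<le> 2 * (F\<^sup>2 / (real d)\<^sup>2)" by linarith
  qed
  have V02: "integrable M (\<lambda>x. (V0 x)\<^sup>2)" "expectation (\<lambda>x. (V0 x)\<^sup>2) \<le> 2 * (F\<^sup>2 / (real d)\<^sup>2)"
  proof -
    note m = second_moment_centred_squares[OF Nd]
    have eq: "(V0 x)\<^sup>2 = (\<Sum>i\<in>N. (X i x)\<^sup>2 - 1)\<^sup>2 / (real d)\<^sup>2" for x
      by (simp add: V0_def power_divide)
    show "integrable M (\<lambda>x. (V0 x)\<^sup>2)" unfolding eq using m(1) by simp
    have "expectation (\<lambda>x. (V0 x)\<^sup>2) \<le> 2 * F\<^sup>2 / (real d)\<^sup>2"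
      unfolding eq using m(2) by (simp add: divide_right_mono F_def)
    then show "expectation (\<lambda>x. (V0 x)\<^sup>2) \<le> 2 * (F\<^sup>2 / (real d)\<^sup>2)" by simp
  qed
  have Pm: "integrable M P" "expectation P \<le> 9602 * (F / real d)"
  proof -
    note m = second_moment_sum_squares[OF Nd]
    have eq: "(Q x)\<^sup>2 = (\<Sum>i\<in>N. (X i x)\<^sup>2)\<^sup>2 / (real d)\<^sup>2" for x by (simp add: Q_def power_divide)
    have intQ2: "integrable M (\<lambda>x. (Q x)\<^sup>2)" unfolding eq using m(1) by simp
    have Q2: "expectation (\<lambda>x. (Q x)\<^sup>2) \<le> 3"
      unfolding eq using m(2) d0 by (simp add: pos_divide_le_eq)
    have intQ: "integrable M Q"
      unfolding Q_def using Nd by (auto intro!: Bochner_Integration.integrable_sum integrable_X_power)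
    have Peq: "P = (\<lambda>x. (1 + 80 * Q x + 1600 * (Q x)\<^sup>2) * (1 / \<kappa>))"
      by (rule ext) (simp add: P_def power2_eq_square algebra_simps add_divide_distrib)
    show intP: "integrable M P" unfolding Peq using intQ intQ2 by simp
    have "expectation P \<le> expectation (\<lambda>x. (2 + 3200 * (Q x)\<^sup>2) * (1 / \<kappa>))"
    proof (rule integral_mono[OF intP])
      show "integrable M (\<lambda>x. (2 + 3200 * (Q x)\<^sup>2) * (1 / \<kappa>))" using intQ2 by simp
      fix x
      have "0 \<le> (1 - 40 * Q x)\<^sup>2" by simp
      then have "1 + 80 * Q x + 1600 * (Q x)\<^sup>2 \<le> 2 + 3200 * (Q x)\<^sup>2"
        by (simp add: power2_eq_square algebra_simps)
      then show "P x \<le> (2 + 3200 * (Q x)\<^sup>2) * (1 / \<kappa>)"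
        unfolding Peq using \<kappa>(1) by (intro mult_right_mono) auto
    qed
    also have "\<dots> = (2 + 3200 * expectation (\<lambda>x. (Q x)\<^sup>2)) * (1 / \<kappa>)"
      using intQ2 by (simp add: prob_space)
    also have "\<dots> \<le> 9602 * (1 / \<kappa>)" using Q2 \<kappa>(1) by (intro mult_right_mono) auto
    finally show "expectation P \<le> 9602 * (F / real d)" unfolding \<kappa>(2) .
  qed
  define R where "R = real s / (real d * L) + F / real d"
  have L0: "0 < L" using L by simp
  have FR: "F / real d \<le> R" using L0 d0 by (simp add: R_def)
  have step: "integrable M (\<lambda>x. \<kappa> * (W x)\<^sup>2 + P x)" "expectation (\<lambda>x. \<kappa> * (W x)\<^sup>2 + P x) \<le> 9604 * R"
    if "integrable M (\<lambda>x. (W x)\<^sup>2)" "expectation (\<lambda>x. (W x)\<^sup>2) \<le> 2 * (F\<^sup>2 / (real d)\<^sup>2)" for W :: "'a \<Rightarrow> real"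
  proof -
    show "integrable M (\<lambda>x. \<kappa> * (W x)\<^sup>2 + P x)" using that Pm by simp
    have "\<kappa> * expectation (\<lambda>x. (W x)\<^sup>2) \<le> \<kappa> * (2 * (F\<^sup>2 / (real d)\<^sup>2))"
      using that \<kappa>(1) by (intro mult_left_mono) auto
    also have "\<dots> = 2 * (F / real d)" unfolding \<kappa>(3)[symmetric] by simp
    finally show "expectation (\<lambda>x. \<kappa> * (W x)\<^sup>2 + P x) \<le> 9604 * R" using that Pm FR by simp
  qed
  have Ustep: "integrable M (\<lambda>x. a + b * (U k x)\<^sup>2)" "expectation (\<lambda>x. a + b * (U k x)\<^sup>2) \<le> 40000 * R" for k
  proof -
    show "integrable M (\<lambda>x. a + b * (U k x)\<^sup>2)" using U2 by simp
    have "expectation (\<lambda>x. a + b * (U k x)\<^sup>2) = a + b * expectation (\<lambda>x. (U k x)\<^sup>2)"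
      using U2 by (simp add: prob_space)
    also have "\<dots> \<le> a + b * (exp (2 * L / 3) * ((F\<^sup>2 + real s * F) / (real d)\<^sup>2))"
      using U2 ab by (intro add_left_mono mult_left_mono) auto
    finally show "expectation (\<lambda>x. a + b * (U k x)\<^sup>2) \<le> 40000 * R" using ab(4) by (simp add: R_def)
  qed
  have H_sum: "integrable M (\<lambda>x. (\<Sum>k<7::nat. f k x) + (g x + (\<Sum>k\<le>7::nat. \<Sum>j\<le>n. h k j x)) / (2 * \<eta>))"
    "expectation (\<lambda>x. (\<Sum>k<7::nat. f k x) + (g x + (\<Sum>k\<le>7::nat. \<Sum>j\<le>n. h k j x)) / (2 * \<eta>))
      = (\<Sum>k<7::nat. expectation (f k)) + (expectation g + (\<Sum>k\<le>7::nat. \<Sum>j\<le>n. expectation (h k j))) / (2 * \<eta>)"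
    if "\<And>k. integrable M (f k)" "integrable M g" "\<And>k j. integrable M (h k j)"
    for f :: "nat \<Rightarrow> 'a \<Rightarrow> real" and g and h :: "nat \<Rightarrow> nat \<Rightarrow> 'a \<Rightarrow> real"
    using that by (simp_all add: Bochner_Integration.integrable_sum)
  have intH: "integrable M H"
    unfolding H_def by (rule H_sum(1)[OF Ustep(1) step(1)[OF V02] step(1)[OF V2]])
  have "expectation H = (\<Sum>k<7::nat. expectation (\<lambda>x. a + b * (U k x)\<^sup>2))
      + (expectation (\<lambda>x. \<kappa> * (V0 x)\<^sup>2 + P x)
        + (\<Sum>k\<le>7::nat. \<Sum>j\<le>n. expectation (\<lambda>x. \<kappa> * (V k j x)\<^sup>2 + P x))) / (2 * \<eta>)"
    unfolding H_def by (rule H_sum(2)[OF Ustep(1) step(1)[OF V02] step(1)[OF V2]])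
  also have "\<dots> \<le> (\<Sum>k<7::nat. 40000 * R) + (9604 * R + (\<Sum>k\<le>7::nat. \<Sum>j\<le>n. 9604 * R)) / (2 * \<eta>)"
    using \<eta>(1) by (intro add_mono sum_mono Ustep(2) divide_right_mono step(2) V02 V2) auto
  \<comment> \<open>Seven frequencies contribute 40000 each; 8 * (n + 1) cosine averages and one
    average of squares contribute 9604 / 2 each, divided by \<eta>.\<close>
  also have "\<dots> = (280000 + real (8 * n + 9) * 4802 / \<eta>) * R"
    using \<eta>(1) by (simp add: field_simps)
  finally have EH: "expectation H \<le> (280000 + real (8 * n + 9) * 4802 / \<eta>) * R" .
  have H0: "0 \<le> H x" for x
    unfolding H_def P_def using ab \<kappa>(1) \<eta>(1)
    by (intro add_nonneg_nonneg sum_nonneg divide_nonneg_nonneg mult_nonneg_nonneg) auto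
  have "(\<integral>\<^sup>+ x. ennreal (real_of_ereal \<bar>sigmaD_hat_sq d s \<Sigma> (Y x) - ereal v\<bar> / v) \<partial>M)
      \<le> (\<integral>\<^sup>+ x. ennreal (H x) \<partial>M)"
  proof (rule nn_integral_mono_AE)
    show "AE x in M. ennreal (real_of_ereal \<bar>sigmaD_hat_sq d s \<Sigma> (Y x) - ereal v\<bar> / v) \<le> ennreal (H x)"
      using AE_X_nonzero by eventually_elim (intro ennreal_leI pointwise)
  qed
  also have "\<dots> = ennreal (expectation H)"
    using intH H0 by (intro nn_integral_eq_integral) auto
  also have "\<dots> \<le> ennreal ((280000 + real (8 * n + 9) * 4802 / \<eta>) * R)"
    using EH by (rule ennreal_leI)
  finally show ?thesis unfolding R_def L v_def F_def frob(1) .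
qed

end

section \<open>Choice of the absolute constants and transfer to the Gaussian space\<close>

theorem theorem6:
  "\<exists>C > 0. \<exists>c > 0. \<forall>c_star > 0. \<forall>(d::nat) (s::nat) (\<sigma>::real) \<theta> (A::nat \<Rightarrow> nat \<Rightarrow> real) \<Sigma>.
     1 \<le> d \<longrightarrow> 1 \<le> s \<longrightarrow> real s \<le> c * real d \<longrightarrow> \<sigma> > 0 \<longrightarrow> \<theta> \<in> B0 s d \<longrightarrow>
     (\<forall>i<d. \<forall>j<d. \<Sigma> i j = (\<Sum>k<d. A i k * A j k)) \<longrightarrow>
     (\<forall>i<d. \<Sigma> i i \<ge> c_star) \<longrightarrow>
     (\<integral>\<^sup>+ Y. ennreal (real_of_ereal (\<bar>sigmaD_hat_sq d s \<Sigma> Y - ereal (\<sigma>\<^sup>2)\<bar>) / \<sigma>\<^sup>2)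
        \<partial>obs_model d \<theta> \<sigma> A)
     \<le> ennreal (C * (real s / (real d * max 1 (ln (real s / frob_til d \<Sigma>)))
                     + frob_til d \<Sigma> / real d))"
proof -
  obtain \<delta>0 where \<delta>0: "0 < \<delta>0" "\<And>x. 1/4 \<le> x \<Longrightarrow> x \<le> 40 \<Longrightarrow> chi2_1_cdf x + \<delta>0 \<le> chi2_1_cdf (2 * x)"
    using chi2_1_cdf_doubling_gap[of "1/4" 40] by auto
  \<comment> \<open>This also serves as the constant \<open>c\<close>. The range from 1/4 to 40 is
    fixed, so \<delta>, then the majorant, then \<eta> and \<open>C\<close> are chosen before any
    parameter of the model.\<close>
  define \<delta> where "\<delta> = min (1/100) (\<delta>0 / 3)"
  have \<delta>: "0 < \<delta>" "\<delta> \<le> 1/100" "3 * \<delta> \<le> \<delta>0" using \<delta>0(1) by (auto simp: \<delta>_def)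
  have quarter: "0 < (1/4 :: real)" "1/4 \<le> (40 :: real)" by simp_all
  obtain n :: nat and \<gamma> :: "nat \<Rightarrow> real" and w :: real where maj:
    "\<And>x z. 1/4 \<le> x \<Longrightarrow> x \<le> 40 \<Longrightarrow>
       (if z\<^sup>2 \<le> x then 1 else 0) \<le> (\<Sum>j\<le>n. \<gamma> j * cos (real j * w / sqrt x * z))"
    "\<And>x. 1/4 \<le> x \<Longrightarrow> x \<le> 40 \<Longrightarrow>
       (\<Sum>j\<le>n. \<gamma> j * exp (- (real j * w / sqrt x)\<^sup>2 / 2)) \<le> chi2_1_cdf x + \<delta>"
    by (rule trig_majorant_of_interval[OF quarter \<delta>(1)]) (rule that, assumption+)
  have gap: "chi2_1_cdf x + 3 * \<delta> \<le> chi2_1_cdf (2 * x)" if "1/4 \<le> x" "x \<le> 40" for x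
    using \<delta>0(2)[OF that] \<delta>(3) by linarith
  define G where "G = (\<Sum>j\<le>n. \<bar>\<gamma> j\<bar>)"
  have G: "0 \<le> G" unfolding G_def by (intro sum_nonneg) auto
  define \<eta> where "\<eta> = \<delta> / (1 + G)"
  have \<eta>: "0 < \<eta>" "\<eta> \<le> 1" "\<eta> * (\<Sum>j\<le>n. \<bar>\<gamma> j\<bar>) \<le> \<delta>"
    using \<delta> G by (auto simp: \<eta>_def G_def[symmetric] field_simps)
  define C where "C = 280000 + real (8 * n + 9) * 4802 / \<eta>"
  have C: "0 < C" using \<eta> by (simp add: C_def add_pos_nonneg)
  show ?thesis
  proof (rule exI[of _ C], intro conjI C, rule exI[of _ \<delta>], intro conjI allI impI \<delta>(1))
    fix c_star \<sigma> :: real and d s :: nat and \<theta> :: "nat \<Rightarrow> real" and A \<Sigma> :: "nat \<Rightarrow> nat \<Rightarrow> real"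
    assume c_star: "c_star > 0" and d: "1 \<le> d" and s1: "1 \<le> s" and s: "real s \<le> \<delta> * real d"
      and \<sigma>: "\<sigma> > 0" and \<theta>: "\<theta> \<in> B0 s d" and S: "\<forall>i<d. \<forall>j<d. \<Sigma> i j = (\<Sum>k<d. A i k * A j k)"
      and diag: "\<forall>i<d. \<Sigma> i i \<ge> c_star"
    define D where "D i = sqrt (\<Sigma> i i)" for i
    \<comment> \<open>Rows of \<open>A\<close> scaled to unit length, so that \<open>X\<close> is
      the normalised noise and \<rho> its correlation matrix.\<close>
    define B where "B i k = A i k / D i" for i k
    define \<rho> where "\<rho> i j = \<Sigma> i j / (D i * D j)" for i j
    define M where "M = PiM {..<d} (\<lambda>_::nat. std_normal_distribution)"
    define X where "X i z = (\<Sum>k<d. B i k * z k)" for i and z :: "nat \<Rightarrow> real"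
    define T where "T z = restrict (\<lambda>i. \<theta> i + \<sigma> * (\<Sum>j<d. A i j * z j)) {..<d}" for z
    interpret N: real_distribution std_normal_distribution by (rule real_dist_normal_dist)
    interpret P: product_prob_space "\<lambda>_::nat. std_normal_distribution" "{..<d}" by standard
    have D: "0 < D i" "(D i)\<^sup>2 = \<Sigma> i i" if "i < d" for i
      using diag c_star that by (auto simp: D_def intro: less_le_trans dest!: spec[of _ i])
    have BB: "(\<Sum>k<d. B i k * B j k) = \<rho> i j" if "i < d" "j < d" for i j
      using S that by (simp add: B_def \<rho>_def sum_divide_distrib)
    have \<rho>1: "\<rho> i i = 1" if "i < d" for i
      using D[OF that] unfolding \<rho>_def D(2)[OF that, symmetric] by (simp add: power2_eq_square)
    have sq: "(\<Sum>k<d. (B i k)\<^sup>2) = 1" if "i < d" for i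
      using BB[OF that that] \<rho>1[OF that] by (simp add: power2_eq_square)
    have sqp: "(\<Sum>k<d. (B i k + B j k)\<^sup>2) = 2 + 2 * \<rho> i j" if "i < d" "j < d" for i j
    proof -
      have "(\<Sum>k<d. (B i k + B j k)\<^sup>2) = (\<Sum>k<d. (B i k)\<^sup>2) + (\<Sum>k<d. (B j k)\<^sup>2) + 2 * (\<Sum>k<d. B i k * B j k)"
        by (simp add: power2_sum sum.distrib sum_distrib_left mult.assoc)
      then show ?thesis using that by (simp add: sq BB)
    qed
    have sqm: "(\<Sum>k<d. (B i k - B j k)\<^sup>2) = 2 - 2 * \<rho> i j" if "i < d" "j < d" for i j
    proof -
      have "(\<Sum>k<d. (B i k - B j k)\<^sup>2) = (\<Sum>k<d. (B i k)\<^sup>2) + (\<Sum>k<d. (B j k)\<^sup>2) - 2 * (\<Sum>k<d. B i k * B j k)"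
        by (simp add: power2_diff sum.distrib sum_subtractf sum_distrib_left mult.assoc)
      then show ?thesis using that by (simp add: sq BB)
    qed
    have sets_M [measurable_cong]: "sets M = sets (PiM {..<d} (\<lambda>_. borel))"
      unfolding M_def by (intro sets_PiM_cong) auto
    interpret std_gaussian_family M d X \<rho>
    proof (intro std_gaussian_family.intro std_gaussian_family_axioms.intro)
      show "prob_space M" unfolding M_def by (rule P.prob_space_axioms)
      fix i assume i: "i < d"
      show "X i \<in> borel_measurable M" unfolding X_def by measurable
      show "distr M borel (X i) = std_normal_distribution"
        using distr_gaussian_linear_combination[of d "B i"]
        by (simp add: X_def[abs_def] M_def sq[OF i] distr_id2)
      fix j assume j: "j < d"
      show "distr M borel (\<lambda>z. X i z + X j z) = distr std_normal_distribution borel (\<lambda>z. sqrt (2 + 2 * \<rho> i j) * z)"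
        using distr_gaussian_linear_combination[of d "\<lambda>k. B i k + B j k"]
        by (simp add: X_def M_def sqp[OF i j] distrib_right sum.distrib)
      show "distr M borel (\<lambda>z. X i z - X j z) = distr std_normal_distribution borel (\<lambda>z. sqrt (2 - 2 * \<rho> i j) * z)"
        using distr_gaussian_linear_combination[of d "\<lambda>k. B i k - B j k"]
        by (simp add: X_def M_def sqm[OF i j] left_diff_distrib sum_subtractf)
      \<comment> \<open>Both numbers are sums of squares of entries, which bounds the correlation on
        either side.\<close>
      have "0 \<le> 2 + 2 * \<rho> i j" "0 \<le> 2 - 2 * \<rho> i j"
        unfolding sqp[OF i j, symmetric] sqm[OF i j, symmetric] by (intro sum_nonneg; simp)+
      then show "\<bar>\<rho> i j\<bar> \<le> 1" by (auto simp: abs_le_iff)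
    qed
    have frob_eq: "frob_til d \<Sigma> = frob" by (simp add: frob_til_def frob_def \<rho>_def D_def)
    have "1 \<le> frob\<^sup>2"
    proof -
      have "(\<rho> 0 0)\<^sup>2 \<le> (\<Sum>j<d. (\<rho> 0 j)\<^sup>2)" using d by (intro member_le_sum) auto
      also have "\<dots> \<le> (\<Sum>i<d. \<Sum>j<d. (\<rho> i j)\<^sup>2)"
        using d by (intro member_le_sum[where f="\<lambda>i. \<Sum>j<d. (\<rho> i j)\<^sup>2"]) (auto intro: sum_nonneg)
      finally show ?thesis using \<rho>1[of 0] d by (simp add: frob_sq)
    qed
    then have "0 < frob" using frob_nonneg by (cases "frob = 0") auto
    have T_meas: "T \<in> measurable M (PiM {..<d} (\<lambda>_. borel))"
      unfolding T_def by measurable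
    have card: "card {i\<in>{..<d}. \<theta> i / D i \<noteq> 0} \<le> s"
    proof -
      have "card {i\<in>{..<d}. \<theta> i / D i \<noteq> 0} \<le> card {i\<in>{..<d}. \<theta> i \<noteq> 0}" by (intro card_mono) auto
      then show ?thesis using \<theta> by (simp add: B0_def)
    qed
    have y: "Ytil \<Sigma> (T z) i = \<theta> i / D i + \<sigma> * X i z" if "i < d" for z i
      using that by (simp add: Ytil_def T_def X_def B_def D_def add_divide_distrib sum_divide_distrib sum_distrib_left)
    have "(\<integral>\<^sup>+ Y. ennreal (real_of_ereal \<bar>sigmaD_hat_sq d s \<Sigma> Y - ereal (\<sigma>\<^sup>2)\<bar> / \<sigma>\<^sup>2) \<partial>obs_model d \<theta> \<sigma> A)
       \<le> (\<integral>\<^sup>+ z. ennreal (real_of_ereal \<bar>sigmaD_hat_sq d s \<Sigma> (T z) - ereal (\<sigma>\<^sup>2)\<bar> / \<sigma>\<^sup>2) \<partial>M)"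
      unfolding obs_model_def T_def[abs_def, symmetric] M_def[symmetric] by (rule nn_integral_distr_le[OF T_meas])
    also have "\<dots> \<le> ennreal (C * (real s / (real d * max 1 (ln (real s / frob_til d \<Sigma>))) + frob_til d \<Sigma> / real d))"
      unfolding C_def
      by (rule risk_bound[OF d s1 \<sigma> \<delta>(1,2) s card y frob_eq \<open>0 < frob\<close> maj gap \<eta>])
    finally show "(\<integral>\<^sup>+ Y. ennreal (real_of_ereal \<bar>sigmaD_hat_sq d s \<Sigma> Y - ereal (\<sigma>\<^sup>2)\<bar> / \<sigma>\<^sup>2) \<partial>obs_model d \<theta> \<sigma> A)
       \<le> ennreal (C * (real s / (real d * max 1 (ln (real s / frob_til d \<Sigma>))) + frob_til d \<Sigma> / real d))" .
  qed
qed

end
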